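(* Let $\mathcal G$ be a connected and compact metric tree with standard conditions at all vertices of $\mathcal G$, and let $-\Delta$ be the corresponding Laplacian. Then there exist a strictly increasing infinite sequence $(\lambda_k)_{k\in\mathbb N}$ of eigenvalues of $-\Delta$, each of multiplicity one, and a sequence $(\psi_k)_{k\in\mathbb N}$ of corresponding eigenfunctions ($-\Delta\psi_k=\lambda_k\psi_k$, $\psi_k\neq 0$) such that for every $k$ one has $\psi_k(\mathsf v)\neq 0$ at every vertex $\mathsf v$ of $\mathcal G$.
   Context: Metric graphs: a compact metric graph $\mathcal G=(\mathsf G,\ell)$ consists of a finite combinatorial graph $\mathsf G$ with vertex set $\mathsf V$ and non-empty edge set $\mathsf E$ (without loops; parallel edges allowed) in which each edge $\mathsf e$ is identified with an interval $[0,\ell_{\mathsf e}]$, $\ell_{\mathsf e}\in(0,\infty)$; the endpoints $0$ and $\ell_{\mathsf e}$ are identified with the initial and the terminal vertex of $\mathsf e$. It is connected if $\mathsf G$ is connected, and a tree if $\mathsf G$ is a tree. $\mathsf E_{\mathsf v}$ denotes the set of edges incident to $\mathsf v$. Laplacian with standard conditions: $-\Delta$ acts edgewise as $-\frac{\mathrm d^2}{\mathrm dx_{\mathsf e}^2}$ in $L^2(\mathcal G)=\bigoplus_{\mathsf e}L^2(0,\ell_{\mathsf e})$ on functions $f$ that are edgewise in the Sobolev space $H^2(0,\ell_{\mathsf e})$ and satisfy standard conditions at every vertex $\mathsf v$: $f$ is continuous at $\mathsf v$ (all limits from incident edges coincide, the common value being $f(\mathsf v)$) and $\sum_{\mathsf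 e\in\mathsf E_{\mathsf v}}\partial_{\mathsf e}f(\mathsf v)=0$, where $\partial_{\mathsf e}f(\mathsf v)$ is the outward derivative of $f$ on $\mathsf e$ at $\mathsf v$, i.e. $-f_{\mathsf e}'(0)$ if $\mathsf v$ is the initial vertex of $\mathsf e$ and $f_{\mathsf e}'(\ell_{\mathsf e})$ if $\mathsf v$ is the terminal vertex. This operator is self-adjoint and non-negative with purely discrete spectrum. *)

theory Defs
  imports
    "HOL-Analysis.Analysis"
    "HOL-Library.Function_Algebras"
    "Graph_Theory.Digraph_Component"
begin

section \<open>Compact metric graphs and trees\<close>

text \<open>
  The combinatorial graph is a finite loop-free multigraph. The direction of an arc
  records only the parametrisation of the edge: \<open>tail G e\<close> is the initial vertex
  (the endpoint \<open>0\<close>) and \<open>head G e\<close> the terminal vertex (the endpoint \<open>ell e\<close>).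
  The constant \<^const>\<open>Digraph_Component.connected\<close> ignores directions.
\<close>

locale compact_metric_graph = fin_digraph G + loopfree_digraph G
  for G :: "('v, 'e) pre_digraph" and ell :: "'e \<Rightarrow> real" +
  assumes arcs_nonempty: "arcs G \<noteq> {}"
    and length_pos: "e \<in> arcs G \<Longrightarrow> 0 < ell e"

text \<open>
  The library's \<^const>\<open>forest\<close> and \<^const>\<open>tree\<close> only exclude directed cycles, so
  undirected cycles are introduced here: \<open>n\<close> distinct vertices \<open>vs 0, \<dots>, vs (n - 1)\<close> and
  \<open>n\<close> distinct edges, \<open>es i\<close> joining \<open>vs i\<close> to the cyclically next vertex. Two parallel
  edges form a cycle of length 2.
\<close>

definition undirected_cycle ::
    "('v, 'e) pre_digraph \<Rightarrow> nat \<Rightarrow> (nat \<Rightarrow> 'v) \<Rightarrow> (nat \<Rightarrow> 'e) \<Rightarrow> bool" where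
  "undirected_cycle G n vs es \<longleftrightarrow>
     0 < n \<and> inj_on vs {..<n} \<and> inj_on es {..<n} \<and>
     (\<forall>i<n. es i \<in> arcs G \<and> {tail G (es i), head G (es i)} = {vs i, vs (Suc i mod n)})"

definition undirected_tree :: "('v, 'e) pre_digraph \<Rightarrow> bool" where
  "undirected_tree G \<longleftrightarrow>
     Digraph_Component.connected G \<and> \<not> (\<exists>n vs es. undirected_cycle G n vs es)"


section \<open>Sobolev spaces on an interval\<close>

definition L2_interval :: "real \<Rightarrow> (real \<Rightarrow> complex) set" where
  "L2_interval l = {f. set_borel_measurable lborel {0<..<l} f \<and>
                       set_integrable lborel {0<..<l} (\<lambda>x. (cmod (f x))\<^sup>2)}"

text \<open>The test functions are \<open>C\<^sub>c\<^sup>\<infinity>(0, l)\<close>, extended by zero to the real line.\<close>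

definition test_functions :: "real \<Rightarrow> (real \<Rightarrow> real) set" where
  "test_functions l = {\<phi>. (\<forall>k x. (deriv ^^ k) \<phi> differentiable (at x)) \<and>
                          (\<exists>a b. 0 < a \<and> b < l \<and> (\<forall>x. x \<notin> {a..b} \<longrightarrow> \<phi> x = 0))}"

definition weak_derivative :: "nat \<Rightarrow> real \<Rightarrow> (real \<Rightarrow> complex) \<Rightarrow> (real \<Rightarrow> complex) \<Rightarrow> bool" where
  "weak_derivative k l f g \<longleftrightarrow>
     (\<forall>\<phi>\<in>test_functions l.
        (LINT x:{0<..<l}|lborel. f x * of_real ((deriv ^^ k) \<phi> x)) =
        (-1) ^ k * (LINT x:{0<..<l}|lborel. g x * of_real (\<phi> x)))"

definition sobolev_H :: "nat \<Rightarrow> real \<Rightarrow> (real \<Rightarrow> complex) set" where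
  "sobolev_H m l = {f \<in> L2_interval l. \<forall>k\<in>{1..m}. \<exists>g\<in>L2_interval l. weak_derivative k l f g}"


section \<open>The Laplacian with standard conditions\<close>

text \<open>
  A function on the metric graph is a family \<open>f e x\<close>, with \<open>x \<in> {0..ell e}\<close>. Elements of the
  domain are given by their continuous representatives, set to zero outside the graph, so that
  each element of \<open>L\<^sup>2\<close> in the domain corresponds to exactly one such family.
\<close>

definition edgewise_H2 ::
    "('v, 'e) pre_digraph \<Rightarrow> ('e \<Rightarrow> real) \<Rightarrow> ('e \<Rightarrow> real \<Rightarrow> complex) set" where
  "edgewise_H2 G ell =
     {f. (\<forall>e\<in>arcs G. f e \<in> sobolev_H 2 (ell e) \<and> continuous_on {0..ell e} (f e)) \<and>
         (\<forall>e x. e \<notin> arcs G \<or> x \<notin> {0..ell e} \<longrightarrow> f e x = 0)}"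

definition has_vertex_value ::
    "('v, 'e) pre_digraph \<Rightarrow> ('e \<Rightarrow> real) \<Rightarrow> ('e \<Rightarrow> real \<Rightarrow> complex) \<Rightarrow> 'v \<Rightarrow> complex \<Rightarrow> bool" where
  "has_vertex_value G ell f v c \<longleftrightarrow>
     (\<forall>e\<in>out_arcs G v. (f e \<longlongrightarrow> c) (at_right 0)) \<and>
     (\<forall>e\<in>in_arcs G v. (f e \<longlongrightarrow> c) (at_left (ell e)))"

definition vertex_value ::
    "('v, 'e) pre_digraph \<Rightarrow> ('e \<Rightarrow> real) \<Rightarrow> ('e \<Rightarrow> real \<Rightarrow> complex) \<Rightarrow> 'v \<Rightarrow> complex" where
  "vertex_value G ell f v = (THE c. has_vertex_value G ell f v c)"

text \<open>
  The continuous representative of an \<open>H\<^sup>2\<close> function is continuously differentiable on the closed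
  interval, so the boundary values of its derivative are the one-sided derivatives.
\<close>

definition outward_derivative ::
    "('v, 'e) pre_digraph \<Rightarrow> ('e \<Rightarrow> real) \<Rightarrow> ('e \<Rightarrow> real \<Rightarrow> complex) \<Rightarrow> 'v \<Rightarrow> 'e \<Rightarrow> complex" where
  "outward_derivative G ell f v e =
     (if tail G e = v
      then - vector_derivative (f e) (at 0 within {0..ell e})
      else vector_derivative (f e) (at (ell e) within {0..ell e}))"

definition standard_conditions ::
    "('v, 'e) pre_digraph \<Rightarrow> ('e \<Rightarrow> real) \<Rightarrow> ('e \<Rightarrow> real \<Rightarrow> complex) \<Rightarrow> 'v \<Rightarrow> bool" where
  "standard_conditions G ell f v \<longleftrightarrow>
     (\<exists>c. has_vertex_value G ell f v c) \<and>
     (\<Sum>e\<in>out_arcs G v \<union> in_arcs G v. outward_derivative G ell f v e) = 0"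

definition laplacian_domain ::
    "('v, 'e) pre_digraph \<Rightarrow> ('e \<Rightarrow> real) \<Rightarrow> ('e \<Rightarrow> real \<Rightarrow> complex) set" where
  "laplacian_domain G ell =
     {f \<in> edgewise_H2 G ell. \<forall>v\<in>verts G. standard_conditions G ell f v}"

text \<open>
  The graph of the operator \<open>- \<Delta>\<close>: the family \<open>g\<close> is a representative of \<open>- \<Delta> f\<close>, which is
  determined almost everywhere on each edge.
\<close>

definition neg_laplacian ::
    "('v, 'e) pre_digraph \<Rightarrow> ('e \<Rightarrow> real) \<Rightarrow>
     ('e \<Rightarrow> real \<Rightarrow> complex) \<Rightarrow> ('e \<Rightarrow> real \<Rightarrow> complex) \<Rightarrow> bool" where
  "neg_laplacian G ell f g \<longleftrightarrow>
     f \<in> laplacian_domain G ell \<and>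
     (\<forall>e\<in>arcs G. g e \<in> L2_interval (ell e) \<and> weak_derivative 2 (ell e) (f e) (\<lambda>x. - g e x))"

definition fun_scale :: "complex \<Rightarrow> ('e \<Rightarrow> real \<Rightarrow> complex) \<Rightarrow> 'e \<Rightarrow> real \<Rightarrow> complex" where
  "fun_scale c f = (\<lambda>e x. c * f e x)"

interpretation fun_scale: vector_space fun_scale
  by unfold_locales (simp_all add: fun_scale_def fun_eq_iff algebra_simps)

definition eigenspace ::
    "('v, 'e) pre_digraph \<Rightarrow> ('e \<Rightarrow> real) \<Rightarrow> complex \<Rightarrow> ('e \<Rightarrow> real \<Rightarrow> complex) set" where
  "eigenspace G ell \<mu> = {f. neg_laplacian G ell f (fun_scale \<mu> f)}"

definition is_eigenvalue :: "('v, 'e) pre_digraph \<Rightarrow> ('e \<Rightarrow> real) \<Rightarrow> complex \<Rightarrow> bool" where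
  "is_eigenvalue G ell \<mu> \<longleftrightarrow> (\<exists>f\<in>eigenspace G ell \<mu>. f \<noteq> 0)"

definition eigenvalue_multiplicity ::
    "('v, 'e) pre_digraph \<Rightarrow> ('e \<Rightarrow> real) \<Rightarrow> complex \<Rightarrow> nat" where
  "eigenvalue_multiplicity G ell \<mu> = fun_scale.dim (eigenspace G ell \<mu>)"

end

theory Submission
  imports Defs "HOL-Computational_Algebra.Polynomial"
begin

text \<open>
  If \<open>k * ell e\<close> is a multiple of \<open>2 * pi\<close> for all edges, then \<open>cos (k x)\<close> on every edge is an
  eigenfunction for \<open>k\<^sup>2\<close> with value 1 at all vertices. By Dirichlet's simultaneous approximation
  theorem there are arbitrarily large \<open>k\<close> for which this nearly holds. Near such a \<open>k\<close>, eliminating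
  the leaves of the tree one after the other yields a Robin condition at the last remaining vertex
  whose coupling depends continuously on \<open>k\<close> and changes sign, and whose zero is an eigenvalue with
  an eigenfunction close to the above one, hence non-zero at all vertices.

  Such an eigenvalue is simple: for any other eigenfunction, the Wronskians on the edges
  form a flow without sources. A flow without sources on a tree vanishes, so both functions
  are proportional on each edge, with the same factor on all edges by connectedness.
\<close>

section \<open>Growing a tree leaf by leaf\<close>

text \<open>The danger in eliminating leaves is a vanishing denominator: the coupling passed to the
  neighbour would blow up and jump as \<open>k\<close> varies. Cosines near 1 prevent this only
  while the couplings stay small, and couplings accumulate towards the last vertex. One elimination
  enlarges their bound by a factor of at most 4, which dictates how well the common period must be
  approximated: up to \<open>1 / 4 ^ card (verts G)\<close>.

  The sign change comes from a window of \<open>k\<close> at whose left end all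
  \<open>sin (k * ell e)\<close> are \<le> 0 and at whose right end all are \<ge> 0; elimination
  preserves these signs. \<open>grown_tree\<close> supplies the order of elimination as an induction
  principle. Vertex values are non-zero because putting a leaf back divides a non-zero value by a
  non-zero denominator; the distance to the cosines is never estimated.

  Multiplicity one concerns the whole eigenspace, whose members solve the equation only weakly.
  Hence the regularity result, proved by mollification, that they are trigonometric on every
  edge.\<close>

inductive grown_tree :: "('v, 'e) pre_digraph \<Rightarrow> 'v set \<Rightarrow> 'e set \<Rightarrow> bool"
  for G :: "('v, 'e) pre_digraph" where
  root: "grown_tree G {r} {}"
| leaf: "grown_tree G V E \<Longrightarrow> p \<in> V \<Longrightarrow> v \<notin> V \<Longrightarrow> {tail G e, head G e} = {p, v} \<Longrightarrow>
    grown_tree G (insert v V) (insert e E)"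

lemma grown_tree_wf:
  assumes "grown_tree G V E"
  shows "finite V" "V \<noteq> {}" "finite E" "e \<in> E \<Longrightarrow> tail G e \<in> V \<and> head G e \<in> V"
proof -
  have "finite V \<and> V \<noteq> {} \<and> finite E \<and> (\<forall>e\<in>E. tail G e \<in> V \<and> head G e \<in> V)"
    using assms by induction (auto simp: doubleton_eq_iff)
  then show "finite V" "V \<noteq> {}" "finite E" "e \<in> E \<Longrightarrow> tail G e \<in> V \<and> head G e \<in> V"
    by auto
qed

text \<open>A path with \<open>n\<close> edges and \<open>n + 1\<close> vertices, where
  \<open>n = 0\<close> is allowed. Both sequences are injective because closing the path by one more
  edge has to meet the two injectivity demands of \<open>undirected_cycle\<close>.\<close>

definition simple_path ::
    "('v, 'e) pre_digraph \<Rightarrow> 'v set \<Rightarrow> 'e set \<Rightarrow> nat \<Rightarrow> (nat \<Rightarrow> 'v) \<Rightarrow> (nat \<Rightarrow> 'e) \<Rightarrow> bool" where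
  "simple_path G V E n vs es \<longleftrightarrow>
     inj_on vs {..n} \<and> inj_on es {..<n} \<and> vs ` {..n} \<subseteq> V \<and>
     (\<forall>i<n. es i \<in> E \<and> {tail G (es i), head G (es i)} = {vs i, vs (Suc i)})"

lemma simple_path_mono:
  "simple_path G V E n vs es \<Longrightarrow> V \<subseteq> V' \<Longrightarrow> E \<subseteq> E' \<Longrightarrow> simple_path G V' E' n vs es"
  by (auto simp: simple_path_def)

lemma simple_path_rev:
  assumes "simple_path G V E n vs es"
  shows "simple_path G V E n (\<lambda>i. vs (n - i)) (\<lambda>i. es (n - Suc i))"
  unfolding simple_path_def
proof (intro conjI allI impI)
  have vs: "inj_on vs {..n}" and es: "inj_on es {..<n}" and "vs ` {..n} \<subseteq> V"
    and st: "\<And>i. i < n \<Longrightarrow> es i \<in> E \<and> {tail G (es i), head G (es i)} = {vs i, vs (Suc i)}"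
    using assms by (auto simp: simple_path_def)
  then show "(\<lambda>i. vs (n - i)) ` {..n} \<subseteq> V" by auto
  show "inj_on (\<lambda>i. vs (n - i)) {..n}"
  proof (rule inj_onI)
    fix x y assume "x \<in> {..n}" "y \<in> {..n}" "vs (n - x) = vs (n - y)"
    moreover from this have "n - x = n - y" using inj_onD[OF vs, of "n - x" "n - y"] by simp
    ultimately show "x = y" by auto
  qed
  show "inj_on (\<lambda>i. es (n - Suc i)) {..<n}"
  proof (rule inj_onI)
    fix x y assume "x \<in> {..<n}" "y \<in> {..<n}" "es (n - Suc x) = es (n - Suc y)"
    moreover from this have "n - Suc x = n - Suc y"
      using inj_onD[OF es, of "n - Suc x" "n - Suc y"] by auto
    ultimately show "x = y" by auto
  qed
  fix i assume i: "i < n"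
  then have "Suc (n - Suc i) = n - i" by simp
  then show "es (n - Suc i) \<in> E" 
    "{tail G (es (n - Suc i)), head G (es (n - Suc i))} = {vs (n - i), vs (n - Suc i)}"
    using st[of "n - Suc i"] i by auto
qed

lemma simple_path_snoc:
  assumes "simple_path G V E n vs es" "v \<notin> V" "{tail G e, head G e} = {vs n, v}"
    and "\<And>e. e \<in> E \<Longrightarrow> tail G e \<in> V \<and> head G e \<in> V"
  shows "simple_path G (insert v V) (insert e E) (Suc n) (vs(Suc n := v)) (es(n := e))"
proof -
  have "e \<notin> E" using assms(2-4) by (auto simp: doubleton_eq_iff)
  then have es: "inj_on (es(n := e)) {..<Suc n}"
    using assms(1) unfolding simple_path_def inj_on_def lessThan_Suc by auto
  have vs: "inj_on (vs(Suc n := v)) {..Suc n}"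
    using assms(1,2) unfolding simple_path_def inj_on_def atMost_Suc
    by (auto simp: image_subset_iff)
  show ?thesis
    using assms(1,3) es vs unfolding simple_path_def by (auto simp: less_Suc_eq atMost_Suc)
qed

text \<open>In the induction step it suffices to build paths that end at the new leaf
  \<open>v\<close>, by prolonging a path to its neighbour \<open>p\<close>; paths that start at
  \<open>v\<close> are reversals of these.\<close>

lemma grown_tree_path:
  assumes "grown_tree G V E" "u \<in> V" "w \<in> V"
  shows "\<exists>n vs es. simple_path G V E n vs es \<and> vs 0 = u \<and> vs n = w"
  using assms
proof (induction arbitrary: u w)
  case (root r)
  then show ?case
    by (intro exI[of _ 0] exI[of _ "\<lambda>_. r"]) (auto simp: simple_path_def)
next
  case (leaf V E p v e)
  have new: "\<exists>n vs es. simple_path G (insert v V) (insert e E) n vs es \<and> vs 0 = x \<and> vs n = v"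
    if x: "x \<in> V" for x
  proof -
    obtain n vs es where *: "simple_path G V E n vs es" "vs 0 = x" "vs n = p"
      using leaf.IH[OF x leaf.hyps(2)] by blast
    show ?thesis
      using simple_path_snoc[OF *(1) leaf.hyps(3), of e] leaf.hyps(4) *
        grown_tree_wf(4)[OF leaf.hyps(1)]
      by (intro exI[of _ "Suc n"] exI[of _ "vs(Suc n := v)"] exI[of _ "es(n := e)"]) auto
  qed
  consider "u \<in> V" "w \<in> V" | "u = v" "w = v" | "u \<in> V" "w = v" | "u = v" "w \<in> V"
    using leaf.prems by auto
  then show ?case
  proof cases
    case 1
    from leaf.IH[OF this] show ?thesis by (blast intro: simple_path_mono)
  next
    case 2
    then show ?thesis
      by (intro exI[of _ 0] exI[of _ "\<lambda>_. v"]) (auto simp: simple_path_def)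
  next
    case 3
    with new show ?thesis by simp
  next
    case 4
    from new[OF 4(2)] obtain n vs es where
      "simple_path G (insert v V) (insert e E) n vs es" "vs 0 = w" "vs n = v" by blast
    with 4 show ?thesis
      by (intro exI[of _ n] exI[of _ "\<lambda>i. vs (n - i)"] exI[of _ "\<lambda>i. es (n - Suc i)"])
        (auto intro: simple_path_rev)
  qed
qed

text \<open>Used to show that a spanning grown subtree of a graph without cycles misses no arc. The
  closing arc gets the index \<open>n\<close>, where the cyclic successor
  \<open>Suc n mod Suc n\<close> is 0.\<close>

lemma simple_path_close_cycle:
  assumes P: "simple_path G V E n vs es" and E: "E \<subseteq> arcs G"
    and e: "e \<in> arcs G" "e \<notin> E" "{tail G e, head G e} = {vs n, vs 0}"
  shows "undirected_cycle G (Suc n) vs (es(n := e))"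
  unfolding undirected_cycle_def
proof (intro conjI allI impI)
  show "inj_on vs {..<Suc n}"
    using P by (simp add: simple_path_def lessThan_Suc_atMost)
  show "inj_on (es(n := e)) {..<Suc n}"
    using P e(2) unfolding simple_path_def inj_on_def lessThan_Suc by auto
  fix i assume "i < Suc n"
  then consider "i < n" | "i = n" by linarith
  note cases = this
  show "(es(n := e)) i \<in> arcs G" using cases
    by cases (use P E e(1) in \<open>auto simp: simple_path_def\<close>)
  show "{tail G ((es(n := e)) i), head G ((es(n := e)) i)} = {vs i, vs (Suc i mod Suc n)}"
    using cases
  proof cases
    case 1
    then show ?thesis using P by (simp add: simple_path_def)
  next
    case 2
    then show ?thesis using e(3) by simp
  qed
qed simp

text \<open>Without such an arc, \<open>V\<close> would be closed under adjacency in either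
  direction, hence under reachability in the symmetrised graph, and would be all of
  \<open>verts G\<close>.\<close>

lemma connected_crossing_arc:
  assumes "Digraph_Component.connected G" "V \<subseteq> verts G" "V \<noteq> {}" "V \<noteq> verts G"
  obtains e p v where "e \<in> arcs G" "p \<in> V" "v \<notin> V" "{tail G e, head G e} = {p, v}"
proof (rule ccontr)
  assume no: "\<not> thesis"
  obtain u w where uw: "u \<in> V" "w \<in> verts G" "w \<notin> V" using assms(2-4) by blast
  have "u \<rightarrow>\<^sup>*\<^bsub>with_proj (mk_symmetric G)\<^esub> w"
    using assms(1,2) uw
    by (auto simp: Digraph_Component.connected_def strongly_connected_def mk_symmetric_def)
  then have "(u, w) \<in> (arcs_ends (with_proj (mk_symmetric G)))\<^sup>*"
    by (rule reachable_rtranclI)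
  then have "w \<in> V"
  proof (induction rule: rtrancl_induct)
    case base
    show ?case by fact
  next
    case (step x y)
    obtain e where "e \<in> arcs G" "{tail G e, head G e} = {x, y}"
      using step(2) by (auto simp: mk_symmetric_def insert_commute)
    with step(3) that no show ?case by blast
  qed
  with uw show False by simp
qed

text \<open>A grown subtree with maximal vertex set is spanning, since a crossing arc could be
  attached to it otherwise. It then contains all arcs, since a missing one would close a cycle with
  the path between its endpoints.\<close>

lemma (in compact_metric_graph) undirected_tree_grown:
  assumes "undirected_tree G"
  shows "grown_tree G (verts G) (arcs G)"
proof -
  define S where "S = {V. V \<subseteq> verts G \<and> (\<exists>E \<subseteq> arcs G. grown_tree G V E)}"
  have "S \<subseteq> Pow (verts G)" by (auto simp: S_def)
  then have "finite S" by (rule finite_subset) simp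
  obtain e0 where "e0 \<in> arcs G" using arcs_nonempty by blast
  then have "{tail G e0} \<in> S" by (auto simp: S_def intro!: exI[of _ "{}"] root)
  then have "S \<noteq> {}" by blast
  obtain V where V: "V \<in> S" "\<And>W. W \<in> S \<Longrightarrow> V \<subseteq> W \<Longrightarrow> V = W"
    using finite_has_maximal[OF \<open>finite S\<close> \<open>S \<noteq> {}\<close>] by blast
  then obtain E where E: "E \<subseteq> arcs G" "grown_tree G V E" and sub: "V \<subseteq> verts G"
    by (auto simp: S_def)
  have "V = verts G"
  proof (rule ccontr)
    assume "V \<noteq> verts G"
    with connected_crossing_arc[OF _ sub grown_tree_wf(2)[OF E(2)]] assms
    obtain e p v where e: "e \<in> arcs G" "p \<in> V" "v \<notin> V" "{tail G e, head G e} = {p, v}"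
      by (metis undirected_tree_def)
    then have "v \<in> verts G" by (metis insertCI insertE singletonD tail_in_verts head_in_verts)
    with e E sub have "insert v V \<in> S"
      by (auto simp: S_def intro!: exI[of _ "insert e E"] leaf)
    from V(2)[OF this] e(3) show False by blast
  qed
  moreover have "E = arcs G"
  proof (rule ccontr)
    assume "E \<noteq> arcs G"
    then obtain e where e: "e \<in> arcs G" "e \<notin> E" using E by blast
    then have "head G e \<in> V" "tail G e \<in> V" using \<open>V = verts G\<close> by auto
    from grown_tree_path[OF E(2) this] obtain n vs es where
      "simple_path G V E n vs es" "vs 0 = head G e" "vs n = tail G e" by blast
    from simple_path_close_cycle[OF this(1) E(1) e] this assms show False
      by (auto simp: undirected_tree_def)
  qed
  ultimately show ?thesis using E by simp
qed

section \<open>Flows and potentials on a tree\<close>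

lemma grown_tree_flow_zero:
  fixes W :: "'e \<Rightarrow> 'a::ab_group_add"
  assumes "grown_tree G V E"
    and "\<And>v. v \<in> V \<Longrightarrow> sum W {e\<in>E. head G e = v} = sum W {e\<in>E. tail G e = v}"
  shows "\<forall>e\<in>E. W e = 0"
  using assms
proof induction
  case (leaf V E p v e)
  note wf = grown_tree_wf[OF leaf.hyps(1)]
  have E: "tail G d \<noteq> v \<and> head G d \<noteq> v" if "d \<in> E" for d using wf(4)[OF that] leaf.hyps(3) by auto
  have "e \<notin> E" using E leaf.hyps by (auto simp: doubleton_eq_iff)
  have "p \<noteq> v" using leaf.hyps by auto
  \<comment> \<open>The newest leaf \<open>v\<close> meets no edge but \<open>e\<close>, so the
    balance at \<open>v\<close> reads \<open>W e = 0\<close>, whichever way \<open>e\<close> is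
    directed.\<close>
  consider "head G e = v" "tail G e = p" | "head G e = p" "tail G e = v"
    using leaf.hyps(4) by (auto simp: doubleton_eq_iff)
  then have 0: "W e = 0"
  proof cases
    case 1
    with E \<open>p \<noteq> v\<close> have "{d\<in>insert e E. head G d = v} = {e}" "{d\<in>insert e E. tail G d = v} = {}" by auto
    with leaf.prems[of v] show ?thesis by (simp del: insert_iff add: insertI1)
  next
    case 2
    with E \<open>p \<noteq> v\<close> have "{d\<in>insert e E. head G d = v} = {}" "{d\<in>insert e E. tail G d = v} = {e}" by auto
    with leaf.prems[of v] show ?thesis by (simp del: insert_iff add: insertI1)
  qed
  \<comment> \<open>An edge with \<open>W e = 0\<close> can be deleted without disturbing any
    balance, so the smaller tree satisfies the induction hypothesis.\<close>
  have red: "sum W {d\<in>insert e E. P d} = sum W {d\<in>E. P d}" for P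
    by (rule sum.mono_neutral_right) (use wf 0 in auto)
  have "\<forall>d\<in>E. W d = 0" using leaf.IH leaf.prems unfolding red by blast
  with 0 show ?case by simp
qed simp

lemma grown_tree_const:
  assumes "grown_tree G V E" and "\<And>e. e \<in> E \<Longrightarrow> q (tail G e) = q (head G e)"
  shows "\<exists>c. \<forall>v\<in>V. q v = c"
  using assms
proof induction
  case (leaf V E p v e)
  then obtain c where c: "\<forall>v\<in>V. q v = c" by blast
  have "q v = q p" using leaf.prems[of e] leaf.hyps(4) by (auto simp: doubleton_eq_iff)
  with c leaf.hyps(2) show ?case by auto
qed simp

section \<open>Robin problems on trees\<close>

text \<open>
  The values \<open>F\<close> and \<open>B\<close> are the Cauchy data of functions that are
  \<open>F (tail G e) cos (k x) + B e sin (k x)\<close> on each edge, with \<open>c e = cos (k ell e)\<close> and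
  \<open>s e = sin (k ell e)\<close>; \<open>a\<close> is the coupling constant of a Robin condition.
\<close>

definition robin_solution ::
  "('v, 'e) pre_digraph \<Rightarrow> 'v set \<Rightarrow> 'e set \<Rightarrow> ('e \<Rightarrow> 'a::comm_ring_1) \<Rightarrow> ('e \<Rightarrow> 'a) \<Rightarrow>
     ('v \<Rightarrow> 'a) \<Rightarrow> ('v \<Rightarrow> 'a) \<Rightarrow> ('e \<Rightarrow> 'a) \<Rightarrow> bool" where
  "robin_solution G V E c s a F B \<longleftrightarrow>
     (\<forall>e\<in>E. F (head G e) = c e * F (tail G e) + s e * B e) \<and>
     (\<forall>v\<in>V. (\<Sum>e | e \<in> E \<and> head G e = v. c e * B e - s e * F (tail G e)) -
             (\<Sum>e | e \<in> E \<and> tail G e = v. B e) = a v * F v)"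

text \<open>
  Eliminating a leaf \<open>v\<close> attached to \<open>p\<close> turns the condition at \<open>v\<close> into one at \<open>p\<close>: a solution
  has outgoing logarithmic derivative \<open>(a v * c e + s e) / (c e - a v * s e)\<close> on \<open>e\<close> at \<open>p\<close>.
\<close>

lemma robin_solution_leaf:
  fixes F :: "'v \<Rightarrow> 'a::field"
  assumes T: "grown_tree G V E" "p \<in> V" "v \<notin> V" "{tail G e, head G e} = {p, v}"
    and cs: "(c e)\<^sup>2 + (s e)\<^sup>2 = 1" and nz: "c e - a v * s e \<noteq> 0"
    and sol: "robin_solution G V E c s (a(p := a p + (a v * c e + s e) / (c e - a v * s e))) F B"
    and F: "\<forall>u\<in>V. F u \<noteq> 0"
  shows "\<exists>F B. robin_solution G (insert v V) (insert e E) c s a F B \<and> (\<forall>u\<in>insert v V. F u \<noteq> 0)"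
proof -
  note wf = grown_tree_wf[OF T(1)]
  have E: "tail G d \<in> V \<and> head G d \<in> V \<and> tail G d \<noteq> v \<and> head G d \<noteq> v" if "d \<in> E" for d
    using wf(4)[OF that] T(3) by auto
  have eE: "e \<notin> E" using E T by (auto simp: doubleton_eq_iff)
  have pv: "p \<noteq> v" using T by auto
  \<comment> \<open>The value at the leaf: continuing a solution from \<open>v\<close> along
    \<open>e\<close>, with value \<open>\<phi>\<close> and the Robin condition at \<open>v\<close>,
    gives the value \<open>\<phi> * (c e - a v * s e)\<close> at \<open>p\<close>, which must equal
    \<open>F p\<close>.\<close>
  define \<phi> where "\<phi> = F p / (c e - a v * s e)"
  define F' where "F' = F(v := \<phi>)"
  have Fp: "F p = \<phi> * (c e - a v * s e)" using nz by (simp add: \<phi>_def)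
  have Fp': "F' p = \<phi> * (c e - a v * s e)" and Fv: "F' v = \<phi>" using pv Fp by (simp_all add: F'_def)
  have r: "(a v * c e + s e) / (c e - a v * s e) * F p = \<phi> * (a v * c e + s e)"
    using nz by (simp add: Fp)
  have nonzero: "\<forall>u\<in>insert v V. F' u \<noteq> 0"
    using F T nz by (auto simp: F'_def \<phi>_def)
  have solE: "F (head G d) = c d * F (tail G d) + s d * B d" if "d \<in> E" for d
    using sol that by (simp add: robin_solution_def)
  have solV: "(\<Sum>d | d \<in> E \<and> head G d = u. c d * B d - s d * F (tail G d)) -
             (\<Sum>d | d \<in> E \<and> tail G d = u. B d)
      = (if u = p then a p * F p + \<phi> * (a v * c e + s e) else a u * F u)" if "u \<in> V" for u
    using sol that r by (auto simp: robin_solution_def distrib_right)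
  \<comment> \<open>The sine coefficient encodes the derivative at the tail of \<open>e\<close>. If
    the tail is \<open>p\<close>, it is the derivative transported from the leaf; if it is
    \<open>v\<close>, it is read off the Robin condition there.\<close>
  define b where "b = (if tail G e = p then \<phi> * (a v * c e + s e) else - a v * \<phi>)"
  define B' where "B' = B(e := b)"
  have F'E: "F' (tail G d) = F (tail G d)" "F' (head G d) = F (head G d)" "B' d = B d" if "d \<in> E" for d
    using E[OF that] that eE by (auto simp: F'_def B'_def)
  have sumE1: "(\<Sum>d | d \<in> insert e E \<and> head G d = u. c d * B' d - s d * F' (tail G d))
     = (if head G e = u then c e * b - s e * F' (tail G e) else 0)
       + (\<Sum>d | d \<in> E \<and> head G d = u. c d * B d - s d * F (tail G d))" for u
  proof -
    have *: "{d. d \<in> insert e E \<and> head G d = u} = (if head G e = u then insert e else id) {d. d \<in> E \<and> head G d = u}"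
      by auto
    have "(\<Sum>d | d \<in> E \<and> head G d = u. c d * B' d - s d * F' (tail G d)) = 
       (\<Sum>d | d \<in> E \<and> head G d = u. c d * B d - s d * F (tail G d))"
      by (rule sum.cong) (simp_all add: F'E)
    then show ?thesis unfolding * using wf eE by (simp add: B'_def)
  qed
  have sumE2: "(\<Sum>d | d \<in> insert e E \<and> tail G d = u. B' d)
     = (if tail G e = u then b else 0) + (\<Sum>d | d \<in> E \<and> tail G d = u. B d)" for u
  proof -
    have *: "{d. d \<in> insert e E \<and> tail G d = u} = (if tail G e = u then insert e else id) {d. d \<in> E \<and> tail G d = u}"
      by auto
    have "(\<Sum>d | d \<in> E \<and> tail G d = u. B' d) = (\<Sum>d | d \<in> E \<and> tail G d = u. B d)"
      by (rule sum.cong) (simp_all add: F'E)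
    then show ?thesis unfolding * using wf eE by (simp add: B'_def)
  qed
  have emp: "{d. d \<in> E \<and> head G d = v} = {}" "{d. d \<in> E \<and> tail G d = v} = {}"
    using E by auto
  have cs': "c e * c e = 1 - s e * s e" using cs by (simp add: power2_eq_square eq_diff_eq)
  consider (in_leaf) "head G e = v" "tail G e = p" | (out_leaf) "head G e = p" "tail G e = v"
    using T(4) by (auto simp: doubleton_eq_iff)
  then have "robin_solution G (insert v V) (insert e E) c s a F' B'"
  proof cases
    case in_leaf
    have b: "b = \<phi> * (a v * c e + s e)" by (simp add: b_def in_leaf)
    have 1: "c e * (\<phi> * (c e - a v * s e)) + s e * b = \<phi>"
      unfolding b by (simp add: algebra_simps cs')
    have 2: "c e * b - s e * (\<phi> * (c e - a v * s e)) = a v * \<phi>"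
      unfolding b by (simp add: algebra_simps cs')
    show ?thesis unfolding robin_solution_def
    proof (intro conjI ballI)
      fix d assume "d \<in> insert e E"
      then show "F' (head G d) = c d * F' (tail G d) + s d * B' d"
        using F'E solE 1 by (auto simp: in_leaf Fp' Fv B'_def)
    next
      fix u assume u: "u \<in> insert v V"
      show "(\<Sum>d | d \<in> insert e E \<and> head G d = u. c d * B' d - s d * F' (tail G d)) -
             (\<Sum>d | d \<in> insert e E \<and> tail G d = u. B' d) = a u * F' u"
      proof (cases "u = v")
        case True
        then show ?thesis using pv 2 unfolding sumE1 sumE2 by (simp add: emp in_leaf Fp' Fv)
      next
        case False
        then have "u \<in> V" "F' u = F u" using u by (auto simp: F'_def)
        with False solV[of u] pv show ?thesis unfolding sumE1 sumE2
          by (auto simp: in_leaf b algebra_simps split: if_splits)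
      qed
    qed
  next
    case out_leaf
    have b: "b = - a v * \<phi>" using pv by (simp add: b_def out_leaf)
    have 1: "c e * \<phi> + s e * b = \<phi> * (c e - a v * s e)"
      unfolding b by (simp add: algebra_simps)
    have 2: "c e * b - s e * \<phi> = - (\<phi> * (a v * c e + s e))"
      unfolding b by (simp add: algebra_simps)
    show ?thesis unfolding robin_solution_def
    proof (intro conjI ballI)
      fix d assume "d \<in> insert e E"
      then show "F' (head G d) = c d * F' (tail G d) + s d * B' d"
        using F'E solE 1 by (auto simp: out_leaf Fp' Fv B'_def)
    next
      fix u assume u: "u \<in> insert v V"
      show "(\<Sum>d | d \<in> insert e E \<and> head G d = u. c d * B' d - s d * F' (tail G d)) -
             (\<Sum>d | d \<in> insert e E \<and> tail G d = u. B' d) = a u * F' u"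
      proof (cases "u = v")
        case True
        then show ?thesis using pv unfolding sumE1 sumE2 by (simp add: emp out_leaf Fv b)
      next
        case False
        then have "u \<in> V" "F' u = F u" using u by (auto simp: F'_def)
        with False solV[of u] pv 2 show ?thesis unfolding sumE1 sumE2
          by (auto simp: out_leaf Fv algebra_simps split: if_splits)
      qed
    qed
  qed
  with nonzero show ?thesis by blast
qed

text \<open>The cosine is at least 3/4, so the denominator is at least 3/4 - 1/16 = 11/16, while the
  numerator is at most \<open>2 * \<delta>\<close>; and 2 \<le> 3 * 11/16. Added to a coupling of
  size \<open>\<delta>\<close> already present at the neighbour, this yields the growth factor
  4.\<close>

lemma abs_leaf_coupling_le:
  fixes a c s \<delta> :: real
  assumes cs: "c\<^sup>2 + s\<^sup>2 = 1" "0 < c" and "\<bar>a\<bar> \<le> \<delta>" "\<bar>s\<bar> \<le> \<delta>" "\<delta> \<le> 1/4"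
  shows "0 < c - a * s" "\<bar>(a * c + s) / (c - a * s)\<bar> \<le> 3 * \<delta>"
proof -
  have "\<bar>s\<bar>\<^sup>2 \<le> (1/4)\<^sup>2" using assms by (intro power_mono) auto
  then have "(3/4)\<^sup>2 \<le> c\<^sup>2" using cs by (simp add: power2_eq_square)
  then have c: "3/4 \<le> c" by (rule power2_le_imp_le) (use cs in simp)
  have "c\<^sup>2 \<le> 1\<^sup>2" using cs(1) zero_le_power2[of s] unfolding one_power2 by linarith
  then have c1: "c \<le> 1" by (rule power2_le_imp_le) simp
  have "\<bar>a * s\<bar> \<le> (1/4) * (1/4)" unfolding abs_mult using assms by (intro mult_mono) auto
  then have d: "11/16 \<le> c - a * s" using c by linarith
  then show pos: "0 < c - a * s" by linarith
  have "\<bar>a * c\<bar> \<le> \<delta> * 1" unfolding abs_mult using assms c1 by (intro mult_mono) auto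
  then have "\<bar>a * c + s\<bar> \<le> 2 * \<delta>" using assms by linarith
  also have "\<dots> \<le> 3 * \<delta> * (11/16)" using assms by linarith
  also have "\<dots> \<le> 3 * \<delta> * (c - a * s)" using d assms by (intro mult_left_mono) auto
  finally show "\<bar>(a * c + s) / (c - a * s)\<bar> \<le> 3 * \<delta>" using pos by (simp add: abs_divide pos_divide_le_eq)
qed

text \<open>Induction on the tree with the newest leaf eliminated. The hypotheses are shaped to
  survive this: the bound grows from \<open>\<delta>\<close> to \<open>4 * \<delta>\<close> while
  \<open>card V\<close> drops by one, which keeps \<open>4 ^ card V * \<delta>\<close> fixed, and
  the signs at \<open>lo\<close> and \<open>hi\<close> are inherited. Hence \<open>a\<close> and
  \<open>\<delta>\<close> are generalised.\<close>

lemma robin_solution_exists: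
  fixes c s :: "real \<Rightarrow> 'e \<Rightarrow> real" and a :: "real \<Rightarrow> 'v \<Rightarrow> real"
  assumes "grown_tree G V E" and "lo \<le> hi"
    and "\<And>e. e \<in> E \<Longrightarrow> continuous_on {lo..hi} (\<lambda>k. c k e)"
    and "\<And>e. e \<in> E \<Longrightarrow> continuous_on {lo..hi} (\<lambda>k. s k e)"
    and "\<And>e k. e \<in> E \<Longrightarrow> k \<in> {lo..hi} \<Longrightarrow> (c k e)\<^sup>2 + (s k e)\<^sup>2 = 1 \<and> 0 < c k e \<and> \<bar>s k e\<bar> \<le> \<delta>"
    and "\<And>e. e \<in> E \<Longrightarrow> s lo e \<le> 0 \<and> 0 \<le> s hi e"
    and "\<And>v. v \<in> V \<Longrightarrow> continuous_on {lo..hi} (\<lambda>k. a k v)"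
    and "\<And>v. v \<in> V \<Longrightarrow> a lo v \<le> 0 \<and> 0 \<le> a hi v"
    and "\<And>v k. v \<in> V \<Longrightarrow> k \<in> {lo..hi} \<Longrightarrow> \<bar>a k v\<bar> \<le> \<delta>"
    and "4 ^ card V * \<delta> \<le> 1" "0 \<le> \<delta>"
  shows "\<exists>k\<in>{lo..hi}. \<exists>F B. robin_solution G V E (c k) (s k) (a k) F B \<and> (\<forall>v\<in>V. F v \<noteq> 0)"
  using assms
proof (induction arbitrary: a \<delta>)
  case (root r)
  \<comment> \<open>Without edges the condition at the last vertex is
    \<open>0 = a k r * F r\<close>, so any zero of the coupling admits \<open>F = 1\<close>.\<close>
  obtain k where "lo \<le> k" "k \<le> hi" "a k r = 0"
    using IVT'[of "\<lambda>k. a k r" lo 0 hi] root by auto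
  then show ?case
    by (intro bexI[of _ k] exI[of _ "\<lambda>_. 1"]) (auto simp: robin_solution_def)
next
  case (leaf V E p v e)
  have fin: "finite V" using grown_tree_wf leaf.hyps by blast
  have d4: "\<delta> \<le> 1/4"
  proof -
    have "4 * \<delta> \<le> 4 ^ card (insert v V) * \<delta>"
      using leaf.prems(10) fin leaf.hyps(3) by (intro mult_right_mono) auto
    with leaf.prems(9) show ?thesis by linarith
  qed
  have cs: "(c k e)\<^sup>2 + (s k e)\<^sup>2 = 1" "0 < c k e" "\<bar>a k v\<bar> \<le> \<delta>" "\<bar>s k e\<bar> \<le> \<delta>" if "k \<in> {lo..hi}" for k
    using leaf.prems(4,8)[OF _ that] by auto
  have bd: "0 < c k e - a k v * s k e" "\<bar>(a k v * c k e + s k e) / (c k e - a k v * s k e)\<bar> \<le> 3 * \<delta>"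
    if "k \<in> {lo..hi}" for k
    using abs_leaf_coupling_le[OF cs[OF that] d4] by auto
  define a' where "a' = (\<lambda>k. (a k)(p := a k p + (a k v * c k e + s k e) / (c k e - a k v * s k e)))"
  have "\<exists>k\<in>{lo..hi}. \<exists>F B. robin_solution G V E (c k) (s k) (a' k) F B \<and> (\<forall>v\<in>V. F v \<noteq> 0)"
  proof (rule leaf.IH[of "4 * \<delta>" a'])
    show "\<And>d. d \<in> E \<Longrightarrow> continuous_on {lo..hi} (\<lambda>k. c k d)"
      "\<And>d. d \<in> E \<Longrightarrow> continuous_on {lo..hi} (\<lambda>k. s k d)"
      "\<And>d. d \<in> E \<Longrightarrow> s lo d \<le> 0 \<and> 0 \<le> s hi d"
      using leaf.prems by auto
    fix d k assume "d \<in> E" "k \<in> {lo..hi}"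
    then show "(c k d)\<^sup>2 + (s k d)\<^sup>2 = 1 \<and> 0 < c k d \<and> \<bar>s k d\<bar> \<le> 4 * \<delta>"
      using leaf.prems(4)[of d k] leaf.prems(10) by auto
  next
    fix u assume u: "u \<in> V"
    have "continuous_on {lo..hi} (\<lambda>k. a k p + (a k v * c k e + s k e) / (c k e - a k v * s k e))"
      using leaf.prems(2,3)[of e] leaf.prems(6)[of v] leaf.prems(6)[of p] leaf.hyps(2) bd(1)
      by (intro continuous_intros) (auto simp: less_imp_neq[THEN not_sym])
    then show "continuous_on {lo..hi} (\<lambda>k. a' k u)"
      using leaf.prems(6)[of u] u by (cases "u = p") (simp_all add: a'_def)
    \<comment> \<open>Cosine and denominator are positive, so at either end of the window the new
      term has the common sign of the leaf's coupling and the sine.\<close>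
    have le: "(a lo v * c lo e + s lo e) / (c lo e - a lo v * s lo e) \<le> 0"
      using bd(1)[of lo] cs(2)[of lo] leaf.prems(5)[of e] leaf.prems(7)[of v] \<open>lo \<le> hi\<close>
      by (intro divide_nonpos_pos add_nonpos_nonpos mult_nonpos_nonneg) auto
    have ge: "0 \<le> (a hi v * c hi e + s hi e) / (c hi e - a hi v * s hi e)"
      using bd(1)[of hi] cs(2)[of hi] leaf.prems(5)[of e] leaf.prems(7)[of v] \<open>lo \<le> hi\<close>
      by (intro divide_nonneg_pos add_nonneg_nonneg mult_nonneg_nonneg) auto
    show "a' lo u \<le> 0 \<and> 0 \<le> a' hi u"
      using le ge leaf.prems(7)[of u] u by (auto simp: a'_def)
    fix k assume k: "k \<in> {lo..hi}"
    show "\<bar>a' k u\<bar> \<le> 4 * \<delta>"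
    proof (cases "u = p")
      case True
      with u k have "\<bar>a k p\<bar> \<le> \<delta>" using leaf.prems(8)[of p k] by simp
      with bd(2)[OF k] show ?thesis unfolding a'_def True fun_upd_same by linarith
    next
      case False
      with leaf.prems(8)[of u k] leaf.prems(10) u k show ?thesis by (simp add: a'_def)
    qed
  next
    show "4 ^ card V * (4 * \<delta>) \<le> 1" using leaf.prems(9) leaf.hyps(3) fin by (simp add: mult_ac)
  qed (use \<open>lo \<le> hi\<close> leaf.prems in auto)
  then obtain k F B where k: "k \<in> {lo..hi}"
    and "robin_solution G V E (c k) (s k) (a' k) F B" "\<forall>v\<in>V. F v \<noteq> 0" by blast
  moreover have "c k e - a k v * s k e \<noteq> 0" using bd(1)[OF k] by simp
  ultimately show ?case
    using robin_solution_leaf[OF leaf.hyps, of "c k" "s k" "a k" F B] cs(1)[OF k]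
    unfolding a'_def by blast
qed

text \<open>\<open>W e\<close> is the Wronskian on \<open>e\<close> of the two solutions, up to the
  factor \<open>k\<close>. It is formed at the tail, but
  \<open>(c e)\<^sup>2 + (s e)\<^sup>2 = 1\<close> makes it constant along the edge, so it can be
  read at the head as well. Only \<open>F\<close> has to be non-zero at the vertices, so
  \<open>F'\<close> may be any other solution.\<close>

lemma robin_solution_unique:
  fixes F :: "'v \<Rightarrow> 'a::field"
  assumes T: "grown_tree G V E" and cs: "\<And>e. e \<in> E \<Longrightarrow> (c e)\<^sup>2 + (s e)\<^sup>2 = 1"
    and sol: "robin_solution G V E c s a F B" and nz: "\<And>v. v \<in> V \<Longrightarrow> F v \<noteq> 0"
    and sol': "robin_solution G V E c s a F' B'"
  shows "\<exists>q. (\<forall>v\<in>V. F' v = q * F v) \<and> (\<forall>e\<in>E. B' e = q * B e)"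
proof -
  define W where "W e = F (tail G e) * B' e - B e * F' (tail G e)" for e
  have W: "W e = F (head G e) * (c e * B' e - s e * F' (tail G e))
      - F' (head G e) * (c e * B e - s e * F (tail G e))" if "e \<in> E" for e
  proof -
    have "F (head G e) * (c e * B' e - s e * F' (tail G e))
      - F' (head G e) * (c e * B e - s e * F (tail G e)) = ((c e)\<^sup>2 + (s e)\<^sup>2) * W e"
      using sol sol' that by (simp add: robin_solution_def W_def algebra_simps power2_eq_square)
    then show ?thesis using cs[OF that] by simp
  qed
  have "\<forall>e\<in>E. W e = 0"
  proof (rule grown_tree_flow_zero[OF T])
    fix v assume v: "v \<in> V"
    have 1: "sum W {e\<in>E. head G e = v} =
        F v * (\<Sum>e | e \<in> E \<and> head G e = v. c e * B' e - s e * F' (tail G e))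
      - F' v * (\<Sum>e | e \<in> E \<and> head G e = v. c e * B e - s e * F (tail G e))"
      unfolding sum_distrib_left sum_subtractf[symmetric] by (rule sum.cong) (auto simp: W)
    have 2: "sum W {e\<in>E. tail G e = v} =
        F v * (\<Sum>e | e \<in> E \<and> tail G e = v. B' e) - F' v * (\<Sum>e | e \<in> E \<and> tail G e = v. B e)"
      unfolding sum_distrib_left sum_subtractf[symmetric] by (rule sum.cong) (auto simp: W_def)
    \<comment> \<open>Both solutions share the coupling, so the terms
      \<open>a v * F v * F' v\<close> cancel and the Wronskians balance at \<open>v\<close>.\<close>
    have "(\<Sum>e | e \<in> E \<and> head G e = v. c e * B e - s e * F (tail G e)) =
        (\<Sum>e | e \<in> E \<and> tail G e = v. B e) + a v * F v"
      "(\<Sum>e | e \<in> E \<and> head G e = v. c e * B' e - s e * F' (tail G e)) =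
        (\<Sum>e | e \<in> E \<and> tail G e = v. B' e) + a v * F' v"
      using sol sol' v by (auto simp: robin_solution_def algebra_simps)
    then show "sum W {e\<in>E. head G e = v} = sum W {e\<in>E. tail G e = v}"
      unfolding 1 2 by (simp add: algebra_simps)
  qed
  then have B': "B' e = F' (tail G e) / F (tail G e) * B e" if "e \<in> E" for e
    using that nz grown_tree_wf(4)[OF T that] by (simp add: W_def field_simps)
  obtain q where q: "\<forall>v\<in>V. F' v / F v = q"
  proof (rule exE[OF grown_tree_const[OF T, of "\<lambda>v. F' v / F v"]])
    fix e assume e: "e \<in> E"
    note V = grown_tree_wf(4)[OF T e]
    have "F' (head G e) = F' (tail G e) / F (tail G e) * F (head G e)"
      using sol sol' e V nz B'[OF e] by (simp add: robin_solution_def field_simps)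
    then show "F' (tail G e) / F (tail G e) = F' (head G e) / F (head G e)"
      using V nz by (simp add: field_simps)
  qed
  have "F' v = q * F v" if "v \<in> V" for v using q that nz by auto
  moreover have "B' e = q * B e" if "e \<in> E" for e
    using B'[OF that] q grown_tree_wf(4)[OF T that] by auto
  ultimately show ?thesis by blast
qed

section \<open>Smooth bump functions\<close>

lemma DERIV_zero_quadratic_bound:
  fixes f :: "real \<Rightarrow> real"
  assumes "\<And>y. \<bar>f y\<bar> \<le> C * (y - x)\<^sup>2"
  shows "(f has_real_derivative 0) (at x)"
proof -
  have "f x = 0" using assms[of x] by simp
  have "((\<lambda>y. (f y - f x) / (y - x)) \<longlongrightarrow> 0) (at x)"
  proof (rule Lim_null_comparison)
    have "norm ((f y - f x) / (y - x)) \<le> C * \<bar>y - x\<bar>" if "y \<noteq> x" for y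
      using that assms[of y] \<open>f x = 0\<close>
      by (simp add: abs_divide pos_divide_le_eq mult.assoc power2_eq_square flip: abs_mult)
    then show "\<forall>\<^sub>F y in at x. norm ((f y - f x) / (y - x)) \<le> C * \<bar>y - x\<bar>"
      by (simp add: eventually_at_filter)
    have "((\<lambda>y. C * \<bar>y - x\<bar>) \<longlongrightarrow> C * \<bar>x - x\<bar>) (at x)" by (intro tendsto_intros)
    then show "((\<lambda>y. C * \<bar>y - x\<bar>) \<longlongrightarrow> 0) (at x)" by simp
  qed
  then show ?thesis by (simp add: has_field_derivative_iff)
qed

text \<open>A single term of the exponential series is at most its sum. With
  \<open>u = inverse w\<close> this makes \<open>exp (- inverse w)\<close> beat every power of
  \<open>inverse w\<close>.\<close>

lemma power_le_fact_exp:
  fixes u :: real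
  assumes "0 \<le> u"
  shows "u ^ n \<le> fact n * exp u"
proof -
  have "(\<Sum>i\<in>{n}. inverse (fact i) * u ^ i) \<le> (\<Sum>i. inverse (fact i) * u ^ i)"
    using summable_exp_generic[of u] assms by (intro sum_le_suminf) (auto simp: scaleR_conv_of_real)
  then have "inverse (fact n) * u ^ n \<le> exp u" by (simp add: exp_def scaleR_conv_of_real)
  then show ?thesis by (simp add: field_simps)
qed

text \<open>
  All derivatives of the bump \<open>exp (-1 / (r\<^sup>2 - y\<^sup>2))\<close> on \<open>(-r, r)\<close> are of the following form; at
  the endpoints they are \<open>O((\<bar>y\<bar> - r)\<^sup>2)\<close>, so that their extensions by zero are differentiable.
\<close>

definition bump_term :: "real \<Rightarrow> real poly \<Rightarrow> nat \<Rightarrow> real \<Rightarrow> real" where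
  "bump_term r p n y =
     (if \<bar>y\<bar> < r then poly p y * inverse (r\<^sup>2 - y\<^sup>2) ^ n * exp (- inverse (r\<^sup>2 - y\<^sup>2)) else 0)"

text \<open>The polynomial \<open>[:r\<^sup>2, 0, -1:]\<close> is
  \<open>w = r\<^sup>2 - y\<^sup>2\<close>. The formula is the numerator left by the product rule
  when everything is put over the denominator \<open>w ^ (n + 2)\<close>.\<close>

definition bump_deriv_poly :: "real \<Rightarrow> real poly \<Rightarrow> nat \<Rightarrow> real poly" where
  "bump_deriv_poly r p n =
     pderiv p * [:r\<^sup>2, 0, -1:] ^ 2 + [:0, 2 * real n:] * [:r\<^sup>2, 0, -1:] * p - [:0, 2:] * p"

text \<open>The exponential absorbs two more powers of \<open>inverse w\<close> than are present,
  which leaves a factor \<open>w\<^sup>2\<close>; and \<open>w = r\<^sup>2 - y\<^sup>2\<close>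
  vanishes linearly at the endpoint, with \<open>w \<le> 2 * r * \<bar>y - x\<bar>\<close>.\<close>

lemma bump_term_quadratic_bound:
  assumes "0 < r" "\<bar>x\<bar> = r"
  shows "\<exists>C. \<forall>y. \<bar>bump_term r p n y\<bar> \<le> C * (y - x)\<^sup>2"
proof -
  have "compact ((\<lambda>y. poly p y) ` {-r..r})"
    by (intro compact_continuous_image continuous_intros) auto
  then obtain K where K: "\<And>y. y \<in> {-r..r} \<Longrightarrow> \<bar>poly p y\<bar> \<le> K"
    using compact_imp_bounded bounded_iff by (metis (no_types, lifting) image_eqI real_norm_def)
  then have "0 \<le> K" using K[of 0] assms by force
  have "\<bar>bump_term r p n y\<bar> \<le> K * fact (n + 2) * (2 * r)\<^sup>2 * (y - x)\<^sup>2" for y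
  proof (cases "\<bar>y\<bar> < r")
    case True
    define w where "w = r\<^sup>2 - y\<^sup>2"
    have "\<bar>y\<bar>\<^sup>2 < r\<^sup>2" using True by (intro power_strict_mono) auto
    then have w: "0 < w" by (simp add: w_def)
    have "inverse w ^ (n + 2) * exp (- inverse w) \<le> fact (n + 2)"
      using power_le_fact_exp[of "inverse w" "n + 2"] w by (simp add: exp_minus field_simps)
    then have "w\<^sup>2 * (inverse w ^ (n + 2) * exp (- inverse w)) \<le> w\<^sup>2 * fact (n + 2)"
      by (intro mult_left_mono) auto
    moreover have "w\<^sup>2 * (inverse w ^ (n + 2) * exp (- inverse w)) = inverse w ^ n * exp (- inverse w)"
      using w by (simp add: field_simps power_add power2_eq_square)
    ultimately have 1: "inverse w ^ n * exp (- inverse w) \<le> w\<^sup>2 * fact (n + 2)" by (simp only:)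
    have "w \<le> 2 * r * \<bar>y - x\<bar>"
    proof (cases "x = r")
      case True
      have "w = (r + y) * (r - y)" by (simp add: w_def power2_eq_square algebra_simps)
      also have "\<dots> \<le> 2 * r * (r - y)" using \<open>\<bar>y\<bar> < r\<close> by (intro mult_right_mono) auto
      finally show ?thesis using True \<open>\<bar>y\<bar> < r\<close> by auto
    next
      case False
      then have "x = - r" using assms by linarith
      have "w = (r - y) * (r + y)" by (simp add: w_def power2_eq_square algebra_simps)
      also have "\<dots> \<le> 2 * r * (r + y)" using \<open>\<bar>y\<bar> < r\<close> by (intro mult_right_mono) auto
      finally show ?thesis using \<open>x = - r\<close> \<open>\<bar>y\<bar> < r\<close> by (auto simp: add.commute)
    qed
    then have "w\<^sup>2 \<le> (2 * r * \<bar>y - x\<bar>)\<^sup>2" using w by (intro power_mono) auto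
    then have 2: "w\<^sup>2 \<le> (2 * r)\<^sup>2 * (y - x)\<^sup>2" by (simp only: power_mult_distrib power2_abs)
    have "\<bar>bump_term r p n y\<bar> = \<bar>poly p y\<bar> * (inverse w ^ n * exp (- inverse w))"
      unfolding bump_term_def w_def[symmetric] using True w by (simp add: abs_mult mult.assoc)
    also have "\<dots> \<le> K * (w\<^sup>2 * fact (n + 2))"
      by (rule mult_mono[OF K 1]) (use True w \<open>0 \<le> K\<close> in auto)
    also have "\<dots> \<le> K * ((2 * r)\<^sup>2 * (y - x)\<^sup>2 * fact (n + 2))"
      by (intro mult_left_mono[OF mult_right_mono[OF 2]]) (use \<open>0 \<le> K\<close> in auto)
    finally show ?thesis by (simp only: mult_ac)
  next
    case False
    then show ?thesis using \<open>0 \<le> K\<close> by (simp add: bump_term_def)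
  qed
  then show ?thesis by blast
qed

lemma bump_term_deriv:
  assumes "0 < r"
  shows "(bump_term r p n has_real_derivative bump_term r (bump_deriv_poly r p n) (n + 2) y) (at y)"
proof -
  consider "\<bar>y\<bar> < r" | "\<bar>y\<bar> = r" | "r < \<bar>y\<bar>" by linarith
  then show ?thesis
  proof cases
    case 1
    define w where "w = r\<^sup>2 - y\<^sup>2"
    have "\<bar>y\<bar>\<^sup>2 < r\<^sup>2" using 1 by (intro power_strict_mono) auto
    then have w: "0 < w" by (simp add: w_def)
    let ?E = "exp (- inverse w)"
    have inv: "((\<lambda>y. inverse (r\<^sup>2 - y\<^sup>2)) has_real_derivative 2 * y * inverse w ^ 2) (at y)"
    proof (rule DERIV_cong)
      have "((\<lambda>y. r\<^sup>2 - y\<^sup>2) has_real_derivative - (2 * y)) (at y)"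
        by (auto intro!: derivative_eq_intros)
      then show "((\<lambda>y. inverse (r\<^sup>2 - y\<^sup>2)) has_real_derivative
          - (inverse (r\<^sup>2 - y\<^sup>2) * - (2 * y) * inverse (r\<^sup>2 - y\<^sup>2))) (at y)"
        by (rule DERIV_inverse') (use w in \<open>simp add: w_def\<close>)
      show "- (inverse (r\<^sup>2 - y\<^sup>2) * - (2 * y) * inverse (r\<^sup>2 - y\<^sup>2)) = 2 * y * inverse w ^ 2"
        unfolding w_def[symmetric] by (simp add: power2_eq_square)
    qed
    have "((\<lambda>y. poly p y * inverse (r\<^sup>2 - y\<^sup>2) ^ n * exp (- inverse (r\<^sup>2 - y\<^sup>2))) has_real_derivative
       (poly (pderiv p) y * inverse w ^ n + poly p y * (real n * inverse w ^ (n - 1) * (2 * y * inverse w ^ 2))) * ?E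
         - poly p y * inverse w ^ n * (?E * (2 * y * inverse w ^ 2))) (at y)"
      by (rule DERIV_cong[OF DERIV_mult'[OF DERIV_mult'[OF poly_DERIV DERIV_power[OF inv]]
            DERIV_fun_exp[OF DERIV_minus[OF inv]]]])
        (simp add: w_def[symmetric] algebra_simps)
    moreover have "(poly (pderiv p) y * inverse w ^ n + poly p y * (real n * inverse w ^ (n - 1) * (2 * y * inverse w ^ 2))) * ?E
         - poly p y * inverse w ^ n * (?E * (2 * y * inverse w ^ 2))
       = poly (bump_deriv_poly r p n) y * inverse w ^ (n + 2) * ?E"
    proof -
      have *: "poly [:r\<^sup>2, 0, -1:] y = w" by (simp add: w_def power2_eq_square algebra_simps)
      have p: "poly (bump_deriv_poly r p n) y =
          poly (pderiv p) y * w\<^sup>2 + 2 * real n * y * w * poly p y - 2 * y * poly p y"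
        unfolding bump_deriv_poly_def poly_add poly_diff poly_mult poly_power * by (simp add: algebra_simps)
      \<comment> \<open>The factor \<open>real n\<close> makes this true even for
        \<open>n = 0\<close>, where \<open>n - 1\<close> is truncated.\<close>
      have n1: "real n * inverse w ^ (n - 1) = real n * inverse w ^ n * w" using w by (cases n) simp_all
      have i: "inverse w ^ (n + 2) = inverse w ^ n * inverse w ^ 2" by (rule power_add)
      have ww: "w\<^sup>2 * (inverse w)\<^sup>2 = 1" "w * (inverse w)\<^sup>2 = inverse w"
        using w by (simp_all add: power2_eq_square field_simps)
      have "poly (bump_deriv_poly r p n) y * inverse w ^ (n + 2) =
          inverse w ^ n * (poly (pderiv p) y * (w\<^sup>2 * (inverse w)\<^sup>2)
            + 2 * real n * y * poly p y * (w * (inverse w)\<^sup>2) - 2 * y * poly p y * (inverse w)\<^sup>2)"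
        unfolding p i by (simp add: algebra_simps)
      also have "\<dots> = poly (pderiv p) y * inverse w ^ n + poly p y * (real n * inverse w ^ (n - 1) * (2 * y * inverse w ^ 2))
           - poly p y * inverse w ^ n * (2 * y * inverse w ^ 2)"
        unfolding n1 ww(1)
        by (simp add: algebra_simps)
      finally show ?thesis by (simp only: left_diff_distrib) (simp only: mult_ac)
    qed
    ultimately have D: "((\<lambda>y. poly p y * inverse (r\<^sup>2 - y\<^sup>2) ^ n * exp (- inverse (r\<^sup>2 - y\<^sup>2)))
        has_real_derivative bump_term r (bump_deriv_poly r p n) (n + 2) y) (at y)"
      using 1 by (simp add: bump_term_def w_def[symmetric])
    show ?thesis
    proof (rule has_field_derivative_transform_within_open[OF D, of "{-r<..<r}"])
      show "y \<in> {-r<..<r}" using 1 by auto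
      fix z assume "z \<in> {-r<..<r}"
      then have "\<bar>z\<bar> < r" by auto
      then show "poly p z * inverse (r\<^sup>2 - z\<^sup>2) ^ n * exp (- inverse (r\<^sup>2 - z\<^sup>2)) = bump_term r p n z"
        by (simp add: bump_term_def)
    qed simp
  next
    case 2
    then show ?thesis
      using bump_term_quadratic_bound[OF assms 2, of p n] DERIV_zero_quadratic_bound
      by (force simp: bump_term_def)
  next
    case 3
    have "((\<lambda>_. 0) has_real_derivative 0) (at y)" by simp
    then have "(bump_term r p n has_real_derivative 0) (at y)"
    proof (rule has_field_derivative_transform_within_open[of _ _ _ "- {-r..r}"])
      show "y \<in> - {-r..r}" using 3 by auto
      fix z assume "z \<in> - {-r..r}"
      then have "\<not> \<bar>z\<bar> < r" by auto
      then show "0 = bump_term r p n z" by (simp add: bump_term_def)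
    qed auto
    with 3 show ?thesis by (simp add: bump_term_def)
  qed
qed

lemma deriv_bump_term:
  assumes "0 < r"
  shows "deriv (\<lambda>y. bump_term r p n (y - x)) = (\<lambda>y. bump_term r (bump_deriv_poly r p n) (n + 2) (y - x))"
    and "((\<lambda>y. bump_term r p n (y - x)) has_real_derivative
       bump_term r (bump_deriv_poly r p n) (n + 2) (y - x)) (at y)"
proof -
  show *: "((\<lambda>y. bump_term r p n (y - x)) has_real_derivative
       bump_term r (bump_deriv_poly r p n) (n + 2) (y - x)) (at y)" for y
    using bump_term_deriv[OF assms, of p n "y + - x"] unfolding DERIV_shift by simp
  show "deriv (\<lambda>y. bump_term r p n (y - x)) = (\<lambda>y. bump_term r (bump_deriv_poly r p n) (n + 2) (y - x))"
    using * by (intro ext DERIV_imp_deriv)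
qed

text \<open>Two explicit derivatives are enough to differentiate a mollification twice and to test
  the weak equation with a translate of the bump.\<close>

lemma bump_exists:
  assumes "0 < r"
  obtains \<beta> \<beta>1 \<beta>2 :: "real \<Rightarrow> real" where
    "\<And>y. (\<beta> has_real_derivative \<beta>1 y) (at y)"
    "\<And>y. (\<beta>1 has_real_derivative \<beta>2 y) (at y)"
    "continuous_on UNIV \<beta>2"
    "\<And>y. \<bar>y\<bar> < r \<Longrightarrow> 0 < \<beta> y" "\<And>y. r \<le> \<bar>y\<bar> \<Longrightarrow> \<beta> y = 0"
    "\<And>x l. 0 < x - r \<Longrightarrow> x + r < l \<Longrightarrow> (\<lambda>y. \<beta> (y - x)) \<in> test_functions l"
    "\<And>x. (deriv ^^ 2) (\<lambda>y. \<beta> (y - x)) = (\<lambda>y. \<beta>2 (y - x))"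
proof
  let ?b = "bump_term r 1 0"
  let ?p = "bump_deriv_poly r 1 0"
  let ?q = "bump_deriv_poly r ?p (0 + 2)"
  show "(?b has_real_derivative bump_term r ?p (0 + 2) y) (at y)" 
    "(bump_term r ?p (0 + 2) has_real_derivative bump_term r ?q (0 + 2 + 2) y) (at y)" for y
    by (rule bump_term_deriv[OF assms])+
  show "continuous_on UNIV (bump_term r ?q (0 + 2 + 2))"
    using DERIV_isCont[OF bump_term_deriv[OF assms]] by (intro continuous_at_imp_continuous_on) blast
  show "\<bar>y\<bar> < r \<Longrightarrow> 0 < ?b y" "r \<le> \<bar>y\<bar> \<Longrightarrow> ?b y = 0" for y
    by (auto simp: bump_term_def)
  show "(deriv ^^ 2) (\<lambda>y. ?b (y - x)) = (\<lambda>y. bump_term r ?q (0 + 2 + 2) (y - x))" for x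
    by (simp only: numeral_2_eq_2 funpow.simps o_def id_def deriv_bump_term[OF assms])
  fix x l :: real assume xl: "0 < x - r" "x + r < l"
  have "\<exists>p n. (deriv ^^ k) (\<lambda>y. ?b (y - x)) = (\<lambda>y. bump_term r p n (y - x))" for k
  proof (induction k)
    case (Suc k)
    then obtain p n where "(deriv ^^ k) (\<lambda>y. ?b (y - x)) = (\<lambda>y. bump_term r p n (y - x))" by blast
    then show ?case by (auto simp: deriv_bump_term[OF assms])
  qed auto
  then have "(deriv ^^ k) (\<lambda>y. ?b (y - x)) differentiable (at y)" for k y
    using deriv_bump_term(2)[OF assms] by (metis real_differentiable_def)
  moreover have "?b (y - x) = 0" if "y \<notin> {x - r..x + r}" for y
    using that by (auto simp: bump_term_def)
  ultimately show "(\<lambda>y. ?b (y - x)) \<in> test_functions l"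
    using xl unfolding test_functions_def by blast
qed

section \<open>Weak solutions of \<open>f'' = - k\<^sup>2 f\<close>\<close>

text \<open>Passes from the Lebesgue integrals in \<open>weak_derivative\<close> to gauge integrals,
  in which differentiation under the integral and the fundamental theorem are carried out.\<close>

lemma LINT_open_interval:
  fixes h :: "real \<Rightarrow> complex"
  assumes "continuous_on {0..l} h"
  shows "set_integrable lborel {0<..<l} h"
    and "(LINT x:{0<..<l}|lborel. h x) = integral {0..l} h"
proof -
  show *: "set_integrable lborel {0<..<l} h"
    by (rule set_integrable_subset[OF borel_integrable_atLeastAtMost'[OF assms]]) auto
  show "(LINT x:{0<..<l}|lborel. h x) = integral {0..l} h"
    using set_borel_integral_eq_integral(2)[OF *] by (simp add: integral_open_interval_real)
qed

text \<open>Rotating the pair \<open>(k *\<^sub>R g x, g1 x)\<close> by the angle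
  \<open>k * x\<close> gives two constants \<open>A\<close> and \<open>B\<close>, so
  \<open>k *\<^sub>R g\<close> is a combination of cosine and sine; addition theorems then eliminate
  \<open>A\<close> and \<open>B\<close>. As there is no division by
  \<open>sin (k * (w - u))\<close>, the three points are arbitrary.\<close>

lemma trig_ode_solution:
  fixes g :: "real \<Rightarrow> complex"
  assumes S: "convex S" "0 < k"
    and g: "\<And>x. x \<in> S \<Longrightarrow> (g has_vector_derivative g1 x) (at x within S)"
    and g1: "\<And>x. x \<in> S \<Longrightarrow> (g1 has_vector_derivative - (k\<^sup>2 *\<^sub>R g x)) (at x within S)"
    and x: "x \<in> S" "u \<in> S" "w \<in> S"
  shows "sin (k * (w - u)) *\<^sub>R g x = sin (k * (w - x)) *\<^sub>R g u + sin (k * (x - u)) *\<^sub>R g w"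
proof -
  have dc: "((\<lambda>x. cos (k * x)) has_real_derivative - (k * sin (k * x))) (at x within S)"
    and ds: "((\<lambda>x. sin (k * x)) has_real_derivative k * cos (k * x)) (at x within S)" for x
    by (auto intro!: derivative_eq_intros)
  obtain A where A: "\<And>x. x \<in> S \<Longrightarrow> cos (k * x) *\<^sub>R (k *\<^sub>R g x) - sin (k * x) *\<^sub>R g1 x = A"
  proof (rule has_vector_derivative_zero_constant[OF S(1)])
    fix x assume x: "x \<in> S"
    show "((\<lambda>x. cos (k * x) *\<^sub>R (k *\<^sub>R g x) - sin (k * x) *\<^sub>R g1 x) has_vector_derivative 0) (at x within S)"
      by (rule has_vector_derivative_eq_rhs[OF has_vector_derivative_diff[OF
            has_vector_derivative_scaleR[OF dc has_vector_derivative_scaleR[OF DERIV_const g[OF x]]]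
            has_vector_derivative_scaleR[OF ds g1[OF x]]]])
        (simp add: algebra_simps power2_eq_square)
  qed blast
  obtain B where B: "\<And>x. x \<in> S \<Longrightarrow> sin (k * x) *\<^sub>R (k *\<^sub>R g x) + cos (k * x) *\<^sub>R g1 x = B"
  proof (rule has_vector_derivative_zero_constant[OF S(1)])
    fix x assume x: "x \<in> S"
    show "((\<lambda>x. sin (k * x) *\<^sub>R (k *\<^sub>R g x) + cos (k * x) *\<^sub>R g1 x) has_vector_derivative 0) (at x within S)"
      by (rule has_vector_derivative_eq_rhs[OF has_vector_derivative_add[OF
            has_vector_derivative_scaleR[OF ds has_vector_derivative_scaleR[OF DERIV_const g[OF x]]]
            has_vector_derivative_scaleR[OF dc g1[OF x]]]])
        (simp add: algebra_simps power2_eq_square)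
  qed blast
  have sq: "cos t * cos t = 1 - sin t * sin t" for t :: real
    using sin_cos_squared_add2[of t] by (simp add: power2_eq_square eq_diff_eq)
  have kg: "k *\<^sub>R g y = cos (k * y) *\<^sub>R A + sin (k * y) *\<^sub>R B" if "y \<in> S" for y
  proof -
    have *: "a *\<^sub>R (a *\<^sub>R v - b *\<^sub>R v') + b *\<^sub>R (b *\<^sub>R v + a *\<^sub>R v') = (a * a + b * b) *\<^sub>R v"
      for a b and v v' :: complex
      by (simp add: scaleR_add_left scaleR_add_right scaleR_diff_right mult.commute)
    show ?thesis
      unfolding A[OF that, symmetric] B[OF that, symmetric] * by (simp only: sq) simp
  qed
  have trig: "sin (c - a) * cos b = sin (c - b) * cos a + sin (b - a) * cos c"
    "sin (c - a) * sin b = sin (c - b) * sin a + sin (b - a) * sin c" for a b c :: real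
    unfolding sin_diff by (simp_all add: algebra_simps)
  have t1: "sin (k * (w - u)) * cos (k * x) = sin (k * (w - x)) * cos (k * u) + sin (k * (x - u)) * cos (k * w)"
    unfolding right_diff_distrib by (rule trig)
  have t2: "sin (k * (w - u)) * sin (k * x) = sin (k * (w - x)) * sin (k * u) + sin (k * (x - u)) * sin (k * w)"
    unfolding right_diff_distrib by (rule trig)
  have "k *\<^sub>R (sin (k * (w - u)) *\<^sub>R g x) = sin (k * (w - u)) *\<^sub>R (k *\<^sub>R g x)"
    by simp
  also have "\<dots> = (sin (k * (w - u)) * cos (k * x)) *\<^sub>R A + (sin (k * (w - u)) * sin (k * x)) *\<^sub>R B"
    unfolding kg[OF x(1)] by (simp add: scaleR_add_right)
  also have "\<dots> = sin (k * (w - x)) *\<^sub>R (k *\<^sub>R g u) + sin (k * (x - u)) *\<^sub>R (k *\<^sub>R g w)"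
    unfolding t1 t2 kg[OF x(2)] kg[OF x(3)] by (simp add: scaleR_add_left scaleR_add_right)
  also have "\<dots> = k *\<^sub>R (sin (k * (w - x)) *\<^sub>R g u + sin (k * (x - u)) *\<^sub>R g w)"
    by (simp add: scaleR_add_right mult.commute)
  finally show ?thesis using S(2) scaleR_left_imp_eq[of k] by blast
qed

text \<open>The kernel carries the derivative, so continuity of \<open>f\<close> suffices. The minus
  sign comes from differentiating \<open>y - x\<close> in \<open>x\<close>.\<close>

lemma has_vector_derivative_convolution:
  fixes f :: "real \<Rightarrow> complex" and \<beta> \<beta>' :: "real \<Rightarrow> real"
  assumes f: "continuous_on {0..l} f" and \<beta>: "\<And>y. (\<beta> has_real_derivative \<beta>' y) (at y)"
    and \<beta>': "continuous_on UNIV \<beta>'"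
  shows "((\<lambda>x. integral {0..l} (\<lambda>y. \<beta> (y - x) *\<^sub>R f y)) has_vector_derivative
     - integral {0..l} (\<lambda>y. \<beta>' (y - x) *\<^sub>R f y)) (at x within S)"
proof -
  have c\<beta>: "continuous_on UNIV \<beta>"
    using \<beta> DERIV_isCont continuous_at_imp_continuous_on by blast
  have "((\<lambda>x. integral (cbox 0 l) (\<lambda>y. \<beta> (y - x) *\<^sub>R f y)) has_vector_derivative
     integral (cbox 0 l) (\<lambda>y. - (\<beta>' (y - x) *\<^sub>R f y))) (at x within UNIV)"
  proof (rule leibniz_rule_vector_derivative)
    fix x t :: real
    have "((\<lambda>x. \<beta> (t - x)) has_real_derivative - \<beta>' (t - x)) (at x)"
      by (rule DERIV_cong[OF DERIV_chain2[OF \<beta> DERIV_diff[OF DERIV_const DERIV_ident]]]) simp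
    then show "((\<lambda>x. \<beta> (t - x) *\<^sub>R f t) has_vector_derivative - (\<beta>' (t - x) *\<^sub>R f t)) (at x within UNIV)"
      by (intro has_vector_derivative_eq_rhs[OF has_vector_derivative_scaleR[OF _ has_vector_derivative_const]])
        auto
  next
    fix x :: real
    show "(\<lambda>y. \<beta> (y - x) *\<^sub>R f y) integrable_on cbox 0 l"
      using f by (intro integrable_continuous continuous_intros continuous_on_compose2[OF c\<beta>]) auto
  next
    show "continuous_on (UNIV \<times> cbox 0 l) (\<lambda>(x, t). - (\<beta>' (t - x) *\<^sub>R f t))"
      unfolding split_beta
      by (intro continuous_intros continuous_on_compose2[OF \<beta>'] continuous_on_compose2[OF f]) auto
  qed auto
  then show ?thesis
    by (auto intro: has_vector_derivative_at_within)
qed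

text \<open>Moves the translation from the kernel to \<open>f\<close>, so that mollifications at
  different points become integrals against the same weight and can be combined.\<close>

lemma integral_shifted_bump:
  fixes f :: "real \<Rightarrow> complex"
  assumes "0 \<le> x - r" "x + r \<le> l" "\<And>y. r \<le> \<bar>y\<bar> \<Longrightarrow> \<beta> y = 0"
  shows "integral {0..l} (\<lambda>y. \<beta> (y - x) *\<^sub>R f y) = integral {-r..r} (\<lambda>h. \<beta> h *\<^sub>R f (x + h))"
proof -
  have "integral {0..l} (\<lambda>y. \<beta> (y - x) *\<^sub>R f y) = integral {x-r..x+r} (\<lambda>y. \<beta> (y - x) *\<^sub>R f y)"
  proof (rule integral_spike_set)
    have "{y \<in> {0..l} - {x-r..x+r}. \<beta> (y - x) *\<^sub>R f y \<noteq> 0} = {}"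
      using assms(3) by force
    then show "negligible {y \<in> {0..l} - {x-r..x+r}. \<beta> (y - x) *\<^sub>R f y \<noteq> 0}" by (simp only: negligible_empty)
    have "{y \<in> {x-r..x+r} - {0..l}. \<beta> (y - x) *\<^sub>R f y \<noteq> 0} = {}" using assms(1,2) by auto
    then show "negligible {y \<in> {x-r..x+r} - {0..l}. \<beta> (y - x) *\<^sub>R f y \<noteq> 0}" by (simp only: negligible_empty)
  qed
  also have "\<dots> = integral {-r..r} (\<lambda>h. \<beta> h *\<^sub>R f (x + h))"
    using integral_shift_Icc_real[of "-r" r "\<lambda>y. \<beta> (y - x) *\<^sub>R f y" x]
    by (simp add: o_def add.commute)
  finally show ?thesis .
qed

text \<open>
  Mollifications of a weak solution solve the differential equation classically, hence satisfy this
  three-point relation, which is stable under limits because it involves no derivatives.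
\<close>

lemma weak_solution_trig_relation:
  fixes f :: "real \<Rightarrow> complex"
  assumes f: "continuous_on {0..l} f" and k: "0 < k"
    and weak: "weak_derivative 2 l f (\<lambda>y. - (of_real (k\<^sup>2) * f y))"
    and mem: "x \<in> {0<..<l}" "u \<in> {0<..<l}" "w \<in> {0<..<l}"
  shows "sin (k * (w - u)) *\<^sub>R f x = sin (k * (w - x)) *\<^sub>R f u + sin (k * (x - u)) *\<^sub>R f w"
proof -
  \<comment> \<open>The defect of the relation when all three points are shifted by
    \<open>h\<close>. The coefficients depend only on differences of the points, so they do not
    change with \<open>h\<close>.\<close>
  define Q where "Q h = sin (k * (w - u)) *\<^sub>R f (x + h) - sin (k * (w - x)) *\<^sub>R f (u + h)
     - sin (k * (x - u)) *\<^sub>R f (w + h)" for h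
  have "Q 0 = 0"
  proof (rule ccontr)
    assume Q0: "Q 0 \<noteq> 0"
    \<comment> \<open>Half the distance of the three points from the boundary: shifts by at most
      \<open>m\<close> stay inside the interval.\<close>
    define m where "m = Min {x, u, w, l - x, l - u, l - w} / 2"
    have "0 < Min {x, u, w, l - x, l - u, l - w}" using mem by (subst Min_gr_iff) auto
    then have m: "0 < m" "2 * m \<le> x" "2 * m \<le> u" "2 * m \<le> w" "2 * m \<le> l - x" "2 * m \<le> l - u" "2 * m \<le> l - w"
      by (auto simp: m_def)
    have Qc: "continuous_on {-m..m} Q"
      unfolding Q_def using m by (intro continuous_intros continuous_on_compose2[OF f]) auto
    then obtain d where d: "0 < d" "\<And>h. h \<in> {-m..m} \<Longrightarrow> dist h 0 < d \<Longrightarrow> dist (Q h) (Q 0) < norm (Q 0) / 2"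
      using Qc[unfolded continuous_on_iff, rule_format, of 0 "norm (Q 0) / 2"] Q0 m(1) by auto
    \<comment> \<open>On the support of a bump of radius \<open>r\<close>, \<open>Q\<close> differs
      from \<open>Q 0\<close> by less than half of \<open>norm (Q 0)\<close>.\<close>
    define r where "r = min m (d / 2)"
    have r: "0 < r" "r \<le> m" "r < d" using d(1) m(1) by (auto simp: r_def)
    obtain \<beta> \<beta>1 \<beta>2 where b:
      "\<And>y. (\<beta> has_real_derivative \<beta>1 y) (at y)"
      "\<And>y. (\<beta>1 has_real_derivative \<beta>2 y) (at y)"
      "continuous_on UNIV \<beta>2"
      "\<And>y. \<bar>y\<bar> < r \<Longrightarrow> 0 < \<beta> y" "\<And>y. r \<le> \<bar>y\<bar> \<Longrightarrow> \<beta> y = 0"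
      "\<And>x l. 0 < x - r \<Longrightarrow> x + r < l \<Longrightarrow> (\<lambda>y. \<beta> (y - x)) \<in> test_functions l"
      "\<And>x. (deriv ^^ 2) (\<lambda>y. \<beta> (y - x)) = (\<lambda>y. \<beta>2 (y - x))"
      using bump_exists[OF r(1)] by blast
    have cb: "continuous_on UNIV \<beta>" "continuous_on UNIV \<beta>1"
      by (intro continuous_at_imp_continuous_on ballI DERIV_isCont[OF b(1)] DERIV_isCont[OF b(2)])+
    define g where "g x = integral {0..l} (\<lambda>y. \<beta> (y - x) *\<^sub>R f y)" for x
    define g1 where "g1 x = - integral {0..l} (\<lambda>y. \<beta>1 (y - x) *\<^sub>R f y)" for x
    have gw: "sin (k * (w - u)) *\<^sub>R g x = sin (k * (w - x)) *\<^sub>R g u + sin (k * (x - u)) *\<^sub>R g w"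
    proof (rule trig_ode_solution[where S = "{r<..<l - r}" and ?g1.0 = g1])
      show "x \<in> {r<..<l - r}" "u \<in> {r<..<l - r}" "w \<in> {r<..<l - r}" using m r by auto
      fix z assume z: "z \<in> {r<..<l - r}"
      show "(g has_vector_derivative g1 z) (at z within {r<..<l - r})"
        unfolding g_def g1_def by (rule has_vector_derivative_convolution[OF f b(1) cb(2)])
      have "(g1 has_vector_derivative - (- integral {0..l} (\<lambda>y. \<beta>2 (y - z) *\<^sub>R f y))) (at z within {r<..<l - r})"
        unfolding g1_def
        by (intro has_vector_derivative_minus has_vector_derivative_convolution[OF f b(2,3)])
      moreover have "integral {0..l} (\<lambda>y. \<beta>2 (y - z) *\<^sub>R f y) = - (k\<^sup>2 *\<^sub>R g z)"
      proof -
        have "(\<lambda>y. \<beta> (y - z)) \<in> test_functions l" using b(6) z by simp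
        then have "(LINT y:{0<..<l}|lborel. f y * of_real (\<beta>2 (y - z))) =
          (-1) ^ 2 * (LINT y:{0<..<l}|lborel. - (of_real (k\<^sup>2) * f y) * of_real (\<beta> (y - z)))"
          by (rule bspec[OF weak[unfolded weak_derivative_def], of "\<lambda>y. \<beta> (y - z)", unfolded b(7)])
        also have "(LINT y:{0<..<l}|lborel. f y * of_real (\<beta>2 (y - z))) =
            integral {0..l} (\<lambda>y. f y * of_real (\<beta>2 (y - z)))"
          by (intro LINT_open_interval continuous_intros continuous_on_compose2[OF b(3)] f) auto
        also have "(LINT y:{0<..<l}|lborel. - (of_real (k\<^sup>2) * f y) * of_real (\<beta> (y - z))) =
            integral {0..l} (\<lambda>y. - (of_real (k\<^sup>2) * f y) * of_real (\<beta> (y - z)))"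
          by (intro LINT_open_interval continuous_intros continuous_on_compose2[OF cb(1)] f) auto
        also have "(\<lambda>y. - (of_real (k\<^sup>2) * f y) * of_real (\<beta> (y - z))) =
            (\<lambda>y. (- (k\<^sup>2)) *\<^sub>R (\<beta> (y - z) *\<^sub>R f y))"
          by (simp add: scaleR_conv_of_real mult_ac)
        finally show ?thesis
          unfolding integral_cmul by (simp add: g_def scaleR_conv_of_real mult.commute)
      qed
      ultimately show "(g1 has_vector_derivative - (k\<^sup>2 *\<^sub>R g z)) (at z within {r<..<l - r})" by simp
    qed (use k in auto)
    have shift: "g z = integral {-r..r} (\<lambda>h. \<beta> h *\<^sub>R f (z + h))"
      "(\<lambda>h. \<beta> h *\<^sub>R f (z + h)) integrable_on {-r..r}" if "0 \<le> z - r" "z + r \<le> l" for z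
    proof -
      show "g z = integral {-r..r} (\<lambda>h. \<beta> h *\<^sub>R f (z + h))"
        unfolding g_def by (rule integral_shifted_bump[OF that b(5)])
      show "(\<lambda>h. \<beta> h *\<^sub>R f (z + h)) integrable_on {-r..r}"
        using that by (intro integrable_continuous_interval continuous_intros
            continuous_on_compose2[OF f] continuous_on_compose2[OF cb(1)]) auto
    qed
    have zx: "0 \<le> x - r" "x + r \<le> l" and zu: "0 \<le> u - r" "u + r \<le> l" and zw: "0 \<le> w - r" "w + r \<le> l"
      using m r by auto
    have "((\<lambda>h. sin (k * (w - u)) *\<^sub>R (\<beta> h *\<^sub>R f (x + h)) - sin (k * (w - x)) *\<^sub>R (\<beta> h *\<^sub>R f (u + h))
        - sin (k * (x - u)) *\<^sub>R (\<beta> h *\<^sub>R f (w + h))) has_integral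
        sin (k * (w - u)) *\<^sub>R g x - sin (k * (w - x)) *\<^sub>R g u - sin (k * (x - u)) *\<^sub>R g w) {-r..r}"
      unfolding shift(1)[OF zx] shift(1)[OF zu] shift(1)[OF zw]
      by (intro has_integral_diff has_integral_cmul integrable_integral shift(2) zx zu zw)
    also have "sin (k * (w - u)) *\<^sub>R g x - sin (k * (w - x)) *\<^sub>R g u - sin (k * (x - u)) *\<^sub>R g w = 0"
      using gw by simp
    also have "(\<lambda>h. sin (k * (w - u)) *\<^sub>R (\<beta> h *\<^sub>R f (x + h)) - sin (k * (w - x)) *\<^sub>R (\<beta> h *\<^sub>R f (u + h))
        - sin (k * (x - u)) *\<^sub>R (\<beta> h *\<^sub>R f (w + h))) = (\<lambda>h. \<beta> h *\<^sub>R Q h)"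
      by (simp add: Q_def algebra_simps)
    finally have Qint: "((\<lambda>h. \<beta> h *\<^sub>R Q h) has_integral 0) {-r..r}" .
    have \<beta>int: "\<beta> integrable_on {-r..r}"
      by (intro integrable_continuous_interval continuous_on_subset[OF cb(1)]) auto
    define M where "M = integral {-r..r} \<beta>"
    have \<beta>0: "0 \<le> \<beta> h" for h using b(4)[of h] b(5)[of h] by (cases "\<bar>h\<bar> < r") auto
    have "M \<noteq> 0"
      unfolding M_def using integral_eq_0_iff[of "-r" r \<beta>] continuous_on_subset[OF cb(1)] \<beta>0 r(1) b(4)[of 0]
      by (auto intro!: bexI[of _ 0])
    moreover have "0 \<le> M" unfolding M_def by (rule integral_nonneg[OF \<beta>int]) (rule \<beta>0)
    ultimately have "0 < M" by simp
    have "((\<lambda>h. \<beta> h *\<^sub>R Q 0 - \<beta> h *\<^sub>R Q h) has_integral M *\<^sub>R Q 0 - 0) {-r..r}"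
      unfolding M_def by (intro has_integral_diff Qint has_integral_scaleR_left integrable_integral \<beta>int)
    then have I: "(\<lambda>h. \<beta> h *\<^sub>R (Q 0 - Q h)) integrable_on {-r..r}"
      "integral {-r..r} (\<lambda>h. \<beta> h *\<^sub>R (Q 0 - Q h)) = M *\<^sub>R Q 0"
      by (auto simp: scaleR_diff_right has_integral_iff)
    \<comment> \<open>The weighted mean of \<open>Q\<close> vanishes because the mollification
      satisfies the relation exactly, yet \<open>Q\<close> stays near \<open>Q 0 \<noteq> 0\<close>
      and the weight has positive mass \<open>M\<close>.\<close>
    have "norm (integral {-r..r} (\<lambda>h. \<beta> h *\<^sub>R (Q 0 - Q h))) \<le> integral {-r..r} (\<lambda>h. norm (Q 0) / 2 * \<beta> h)"
    proof (rule integral_norm_bound_integral[OF I(1)])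
      show "(\<lambda>h. norm (Q 0) / 2 * \<beta> h) integrable_on {-r..r}"
        using integrable_cmul[OF \<beta>int, of "norm (Q 0) / 2"] by simp
      fix h assume "h \<in> {-r..r}"
      then have "norm (Q 0 - Q h) \<le> norm (Q 0) / 2"
        using d(2)[of h] r by (auto simp: dist_norm norm_minus_commute abs_if intro!: less_imp_le)
      from mult_right_mono[OF this \<beta>0[of h]]
      show "norm (\<beta> h *\<^sub>R (Q 0 - Q h)) \<le> norm (Q 0) / 2 * \<beta> h"
        using \<beta>0[of h] by (simp add: mult.commute)
    qed
    also have "integral {-r..r} (\<lambda>h. norm (Q 0) / 2 * \<beta> h) = norm (Q 0) / 2 * M"
      unfolding M_def by (rule integral_mult_right)
    finally have "M * norm (Q 0) \<le> norm (Q 0) / 2 * M"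
      unfolding I(2) norm_scaleR using \<open>0 < M\<close> by (simp only: abs_of_pos)
    moreover have "0 < M * norm (Q 0)" using \<open>0 < M\<close> Q0 by (intro mult_pos_pos) simp_all
    ultimately show False by (simp add: mult.commute)
  qed
  then show ?thesis by (simp add: Q_def diff_diff_eq)
qed

lemma weak_solution_trig:
  fixes f :: "real \<Rightarrow> complex"
  assumes f: "continuous_on {0..l} f" and k: "0 < k" and l: "0 < l"
    and weak: "weak_derivative 2 l f (\<lambda>y. - (of_real (k\<^sup>2) * f y))"
  shows "\<exists>A B. \<forall>x\<in>{0..l}. f x = of_real (cos (k * x)) * A + of_real (sin (k * x)) * B"
proof -
  define u where "u = l / 3"
  \<comment> \<open>The gap is short enough that \<open>k * (w - u)\<close> lies in (0, 1], where
    the sine is positive.\<close>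
  define w where "w = u + min (l / 3) (1 / k)"
  have uw: "u \<in> {0<..<l}" "w \<in> {0<..<l}" using l k by (auto simp: u_def w_def intro!: add_pos_pos)
  have "0 < k * (w - u)" "k * (w - u) \<le> 1"
    using k l by (auto simp: w_def min_def field_simps)
  then have S: "0 < sin (k * (w - u))" using pi_gt3 by (intro sin_gt_zero) linarith+
  \<comment> \<open>Cramer's rule for the coefficients that match \<open>f\<close> at
    \<open>u\<close> and \<open>w\<close>; the determinant is
    \<open>sin (k * (w - u))\<close>.\<close>
  define A where "A = (sin (k * w) *\<^sub>R f u - sin (k * u) *\<^sub>R f w) /\<^sub>R sin (k * (w - u))"
  define B where "B = (cos (k * u) *\<^sub>R f w - cos (k * w) *\<^sub>R f u) /\<^sub>R sin (k * (w - u))"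
  define h where "h x = f x - (of_real (cos (k * x)) * A + of_real (sin (k * x)) * B)" for x
  have "h x = 0" if "x \<in> {0<..<l}" for x
  proof -
    have "sin (k * (w - u)) *\<^sub>R h x = sin (k * (w - u)) *\<^sub>R f x
       - (cos (k * x) *\<^sub>R (sin (k * (w - u)) *\<^sub>R A) + sin (k * x) *\<^sub>R (sin (k * (w - u)) *\<^sub>R B))"
      by (simp add: h_def scaleR_conv_of_real algebra_simps)
    also have "sin (k * (w - u)) *\<^sub>R A = sin (k * w) *\<^sub>R f u - sin (k * u) *\<^sub>R f w"
      using S by (simp add: A_def)
    also have "sin (k * (w - u)) *\<^sub>R B = cos (k * u) *\<^sub>R f w - cos (k * w) *\<^sub>R f u"
      using S by (simp add: B_def)
    also have "sin (k * (w - u)) *\<^sub>R f x = sin (k * (w - x)) *\<^sub>R f u + sin (k * (x - u)) *\<^sub>R f w"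
      by (rule weak_solution_trig_relation[OF f k weak that uw])
    finally have "sin (k * (w - u)) *\<^sub>R h x = 0"
      unfolding right_diff_distrib sin_diff by (simp add: algebra_simps)
    then show ?thesis using S by simp
  qed
  moreover have "continuous_on (closure {0<..<l}) h"
    unfolding h_def using l by (auto intro!: continuous_intros f)
  ultimately have "h x = 0" if "x \<in> {0..l}" for x
    using continuous_constant_on_closure[of "{0<..<l}" h 0 x] that l by simp
  then show ?thesis by (auto simp: h_def)
qed

section \<open>Classical derivatives are weak derivatives\<close>

lemma test_functionsD:
  assumes "\<phi> \<in> test_functions l"
  shows "(\<phi> has_real_derivative deriv \<phi> x) (at x)" "deriv \<phi> \<in> test_functions l"
    and "0 < l \<Longrightarrow> \<phi> 0 = 0" "\<phi> l = 0"
proof -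
  have d: "(deriv ^^ k) \<phi> differentiable (at x)" for k x
    using assms by (simp add: test_functions_def)
  from d[of 0] show *: "(\<phi> has_real_derivative deriv \<phi> x) (at x)" for x
    using DERIV_deriv_iff_real_differentiable by auto
  obtain a b where ab: "0 < a" "b < l" "\<And>x. x \<notin> {a..b} \<Longrightarrow> \<phi> x = 0"
    using assms by (auto simp: test_functions_def)
  then show "\<phi> 0 = 0" "\<phi> l = 0" by auto
  have "deriv \<phi> x = 0" if "x \<notin> {a..b}" for x
  proof -
    have "((\<lambda>_. 0) has_real_derivative 0) (at x)" by simp
    then have "(\<phi> has_real_derivative 0) (at x)"
      by (rule has_field_derivative_transform_within_open[of _ _ _ "- {a..b}"])
        (use that ab(3) in auto)
    then show ?thesis by (rule DERIV_imp_deriv)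
  qed
  moreover have "(deriv ^^ k) (deriv \<phi>) differentiable (at x)" for k x
    using d[of "Suc k" x] by (simp add: funpow_swap1)
  ultimately show "deriv \<phi> \<in> test_functions l"
    using ab unfolding test_functions_def by blast
qed

lemma test_functions_continuous:
  assumes "\<phi> \<in> test_functions l"
  shows "continuous_on S \<phi>"
  using DERIV_isCont[OF test_functionsD(1)[OF assms]] by (intro continuous_at_imp_continuous_on ballI)

lemma LINT_by_parts_test_function:
  fixes F F' :: "real \<Rightarrow> complex"
  assumes "0 \<le> l" and F: "\<And>x. (F has_vector_derivative F' x) (at x)"
    and F': "continuous_on UNIV F'" and \<phi>: "\<phi> \<in> test_functions l"
  shows "(LINT x:{0<..<l}|lborel. F x * of_real (deriv \<phi> x)) =
      - (LINT x:{0<..<l}|lborel. F' x * of_real (\<phi> x))"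
proof -
  have cF: "continuous_on S F" for S
    using F has_vector_derivative_continuous by (intro continuous_at_imp_continuous_on) blast
  have c1: "continuous_on {0..l} (\<lambda>x. F x * of_real (deriv \<phi> x))"
    by (intro continuous_intros cF test_functions_continuous[OF test_functionsD(2)[OF \<phi>]])
  have c2: "continuous_on {0..l} (\<lambda>x. F' x * of_real (\<phi> x))"
    by (intro continuous_intros continuous_on_subset[OF F'] test_functions_continuous[OF \<phi>]) auto
  have "((\<lambda>x. F x * of_real (deriv \<phi> x) + F' x * of_real (\<phi> x)) has_integral
      F l * of_real (\<phi> l) - F 0 * of_real (\<phi> 0)) {0..l}"
  proof (rule fundamental_theorem_of_calculus[OF \<open>0 \<le> l\<close>])
    fix x
    have "((\<lambda>x. complex_of_real (\<phi> x)) has_vector_derivative of_real (deriv \<phi> x)) (at x)"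
      using test_functionsD(1)[OF \<phi>] by (rule has_vector_derivative_of_real)
    from has_vector_derivative_mult[OF F this]
    show "((\<lambda>x. F x * of_real (\<phi> x)) has_vector_derivative F x * of_real (deriv \<phi> x) + F' x * of_real (\<phi> x))
        (at x within {0..l})"
      by (rule has_vector_derivative_at_within)
  qed
  moreover have "F l * of_real (\<phi> l) - F 0 * of_real (\<phi> 0) = 0"
    using test_functionsD(3,4)[OF \<phi>] \<open>0 \<le> l\<close> by (cases "l = 0") auto
  moreover have "integral {0..l} (\<lambda>x. F x * of_real (deriv \<phi> x) + F' x * of_real (\<phi> x)) =
     integral {0..l} (\<lambda>x. F x * of_real (deriv \<phi> x)) + integral {0..l} (\<lambda>x. F' x * of_real (\<phi> x))"
    by (intro Henstock_Kurzweil_Integration.integral_add integrable_continuous_interval c1 c2)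
  ultimately have "integral {0..l} (\<lambda>x. F x * of_real (deriv \<phi> x)) + integral {0..l} (\<lambda>x. F' x * of_real (\<phi> x)) = 0"
    by (simp add: has_integral_iff)
  then show ?thesis
    unfolding LINT_open_interval(2)[OF c1] LINT_open_interval(2)[OF c2] by (rule eq_neg_iff_add_eq_0[THEN iffD2])
qed

lemma weak_derivative_classical:
  fixes F F' F'' :: "real \<Rightarrow> complex"
  assumes "0 \<le> l" and F: "\<And>x. (F has_vector_derivative F' x) (at x)"
    and F': "\<And>x. (F' has_vector_derivative F'' x) (at x)"
    and F'': "continuous_on UNIV F''"
  shows "weak_derivative 1 l F F'" "weak_derivative 2 l F F''"
proof -
  have cF': "continuous_on UNIV F'"
    using F' has_vector_derivative_continuous by (intro continuous_at_imp_continuous_on) blast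
  show "weak_derivative 1 l F F'"
    unfolding weak_derivative_def using LINT_by_parts_test_function[OF assms(1) F cF'] by simp
  show "weak_derivative 2 l F F''"
    unfolding weak_derivative_def
  proof
    fix \<phi> assume \<phi>: "\<phi> \<in> test_functions l"
    show "(LINT x:{0<..<l}|lborel. F x * of_real ((deriv ^^ 2) \<phi> x)) =
       (-1) ^ 2 * (LINT x:{0<..<l}|lborel. F'' x * of_real (\<phi> x))"
      using LINT_by_parts_test_function[OF assms(1) F cF' test_functionsD(2)[OF \<phi>]]
        LINT_by_parts_test_function[OF assms(1) F' F'' \<phi>]
      by (simp add: numeral_2_eq_2)
  qed
qed

text \<open>Members of the domain are cut off to zero outside the edge, whereas trigonometric
  functions are differentiated on the whole line; this lets one replace the other.\<close>

lemma weak_derivative_cong: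
  assumes "\<And>x. x \<in> {0<..<l} \<Longrightarrow> f x = f' x" "\<And>x. x \<in> {0<..<l} \<Longrightarrow> g x = g' x"
  shows "weak_derivative k l f g \<longleftrightarrow> weak_derivative k l f' g'"
proof -
  have "(LINT x:{0<..<l}|lborel. f x * h x) = (LINT x:{0<..<l}|lborel. f' x * h x)"
    "(LINT x:{0<..<l}|lborel. g x * h x) = (LINT x:{0<..<l}|lborel. g' x * h x)" for h
    using assms by (auto intro!: set_lebesgue_integral_cong)
  then show ?thesis by (simp add: weak_derivative_def)
qed

lemma continuous_on_L2_interval:
  assumes "continuous_on {0..l} f"
  shows "f \<in> L2_interval l"
proof -
  have "continuous_on {0..l} (\<lambda>x. (cmod (f x))\<^sup>2)" by (intro continuous_intros assms)
  then have "set_integrable lborel {0<..<l} (\<lambda>x. (cmod (f x))\<^sup>2)"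
    by (intro set_integrable_subset[OF borel_integrable_atLeastAtMost']) auto
  then show ?thesis
    using LINT_open_interval(1)[OF assms]
    by (simp add: L2_interval_def set_integrable_def set_borel_measurable_def borel_measurable_integrable)
qed

section \<open>Trigonometric functions on an edge\<close>

definition trig :: "real \<Rightarrow> complex \<Rightarrow> complex \<Rightarrow> real \<Rightarrow> complex" where
  "trig k A B x = of_real (cos (k * x)) * A + of_real (sin (k * x)) * B"

lemma trig_deriv: "(trig k A B has_vector_derivative trig k (of_real k * B) (- (of_real k * A)) x) (at x within S)"
proof -
  have "((\<lambda>x. complex_of_real (cos (k * x))) has_vector_derivative of_real (- (k * sin (k * x)))) (at x within S)"
    "((\<lambda>x. complex_of_real (sin (k * x))) has_vector_derivative of_real (k * cos (k * x))) (at x within S)"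
    by (intro has_vector_derivative_of_real; auto intro!: derivative_eq_intros)+
  then show ?thesis
    unfolding trig_def[abs_def]
    by (auto intro!: derivative_eq_intros simp: algebra_simps)
qed

lemma trig_continuous: "continuous_on S (trig k A B)"
  unfolding trig_def[abs_def] by (intro continuous_intros)

lemma trig_sobolev:
  assumes "0 \<le> l" and f: "\<forall>x\<in>{0..l}. f x = trig k A B x"
  shows "continuous_on {0..l} f" "f \<in> L2_interval l"
    "weak_derivative 2 l f (\<lambda>x. - (of_real (k\<^sup>2) * f x))" "f \<in> sobolev_H 2 l"
proof -
  show c: "continuous_on {0..l} f" by (rule continuous_on_eq[OF trig_continuous]) (use f in simp)
  then show L2: "f \<in> L2_interval l" by (rule continuous_on_L2_interval)
  let ?f1 = "trig k (of_real k * B) (- (of_real k * A))"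
  have W: "weak_derivative 1 l (trig k A B) ?f1"
    "weak_derivative 2 l (trig k A B) (trig k (of_real k * (- (of_real k * A))) (- (of_real k * (of_real k * B))))"
    by (rule weak_derivative_classical[OF assms(1) trig_deriv trig_deriv trig_continuous])+
  have w1: "weak_derivative 1 l f ?f1" using W(1) by (subst weak_derivative_cong) (use f in auto)
  show w2: "weak_derivative 2 l f (\<lambda>x. - (of_real (k\<^sup>2) * f x))"
    using W(2) by (subst weak_derivative_cong) (use f in \<open>auto simp: trig_def algebra_simps power2_eq_square\<close>)
  have "?f1 \<in> L2_interval l" "(\<lambda>x. - (of_real (k\<^sup>2) * f x)) \<in> L2_interval l"
    by (intro continuous_on_L2_interval trig_continuous continuous_intros c)+
  moreover have "{1..2} = {1, 2::nat}" by auto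
  ultimately show "f \<in> sobolev_H 2 l"
    using L2 w1 w2 unfolding sobolev_H_def by auto
qed

lemma trig_one_sided:
  assumes "0 < l" and f: "\<forall>x\<in>{0..l}. f x = trig k A B x"
  shows "(f \<longlongrightarrow> A) (at_right 0)" "(f \<longlongrightarrow> trig k A B l) (at_left l)"
    "vector_derivative f (at 0 within {0..l}) = of_real k * B"
    "vector_derivative f (at l within {0..l}) =
       of_real k * (of_real (cos (k * l)) * B - of_real (sin (k * l)) * A)"
proof -
  have t: "(trig k A B \<longlongrightarrow> trig k A B x) (at x within S)" for x S
    using trig_continuous[of UNIV k A B] by (auto simp: continuous_on_def intro: tendsto_within_subset)
  have "\<forall>\<^sub>F x in at_right 0. trig k A B x = f x"
    using eventually_at_right_real[OF \<open>0 < l\<close>] by (rule eventually_mono) (simp add: f)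
  then show "(f \<longlongrightarrow> A) (at_right 0)"
    using Lim_transform_eventually[OF t[of 0]] by (simp add: trig_def)
  have "\<forall>\<^sub>F x in at_left l. trig k A B x = f x"
    using eventually_at_left_real[OF \<open>0 < l\<close>] by (rule eventually_mono) (simp add: f)
  then show "(f \<longlongrightarrow> trig k A B l) (at_left l)"
    using Lim_transform_eventually[OF t[of l]] by simp
  have d: "vector_derivative f (at x within {0..l}) = trig k (of_real k * B) (- (of_real k * A)) x"
    if "x \<in> {0..l}" for x
  proof (rule vector_derivative_within_closed_interval[OF \<open>0 < l\<close> that])
    show "(f has_vector_derivative trig k (of_real k * B) (- (of_real k * A)) x) (at x within {0..l})"
      by (rule has_vector_derivative_transform[OF that _ trig_deriv]) (use f in simp)
  qed
  from d[of 0] d[of l] \<open>0 < l\<close> show "vector_derivative f (at 0 within {0..l}) = of_real k * B"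
    "vector_derivative f (at l within {0..l}) =
       of_real k * (of_real (cos (k * l)) * B - of_real (sin (k * l)) * A)"
    by (simp_all add: trig_def algebra_simps)
qed

section \<open>Eigenfunctions on the metric graph\<close>

text \<open>The intermediate value argument produces real data, while the eigenspaces are
  complex.\<close>

lemma robin_solution_of_real:
  assumes "robin_solution G V E c s a F B"
  shows "robin_solution G V E (\<lambda>e. of_real (c e)) (\<lambda>e. of_real (s e)) (\<lambda>v. of_real (a v))
     (\<lambda>v. of_real (F v) :: 'a :: {real_algebra_1, comm_ring_1}) (\<lambda>e. of_real (B e))"
  unfolding robin_solution_def
proof (intro conjI ballI)
  fix e assume "e \<in> E"
  then show "of_real (F (head G e)) = of_real (c e) * of_real (F (tail G e)) + of_real (s e) * (of_real (B e) :: 'a)"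
    using assms by (simp add: robin_solution_def)
next
  fix v assume "v \<in> V"
  then have "of_real ((\<Sum>e | e \<in> E \<and> head G e = v. c e * B e - s e * F (tail G e)) -
             (\<Sum>e | e \<in> E \<and> tail G e = v. B e)) = (of_real (a v * F v) :: 'a)"
    using assms by (simp add: robin_solution_def)
  then show "(\<Sum>e | e \<in> E \<and> head G e = v. of_real (c e) * of_real (B e) - of_real (s e) * of_real (F (tail G e))) -
             (\<Sum>e | e \<in> E \<and> tail G e = v. of_real (B e)) = of_real (a v) * (of_real (F v) :: 'a)"
    by simp
qed

definition edge_cos :: "('e \<Rightarrow> real) \<Rightarrow> real \<Rightarrow> 'e \<Rightarrow> complex" where
  "edge_cos ell k e = of_real (cos (k * ell e))"

definition edge_sin :: "('e \<Rightarrow> real) \<Rightarrow> real \<Rightarrow> 'e \<Rightarrow> complex" where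
  "edge_sin ell k e = of_real (sin (k * ell e))"

definition trig_family ::
    "('v, 'e) pre_digraph \<Rightarrow> ('e \<Rightarrow> real) \<Rightarrow> real \<Rightarrow> ('v \<Rightarrow> complex) \<Rightarrow> ('e \<Rightarrow> complex) \<Rightarrow> 'e \<Rightarrow> real \<Rightarrow> complex" where
  "trig_family G ell k F B e x =
     (if e \<in> arcs G \<and> x \<in> {0..ell e} then trig k (F (tail G e)) (B e) x else 0)"

context compact_metric_graph
begin

text \<open>Shows that the derivative condition is the Robin condition with coupling 0, multiplied
  by \<open>k\<close>. Absence of loops makes outgoing and incoming arcs disjoint, so the sum
  splits.\<close>

lemma sum_outward_derivative_trig:
  assumes f: "\<forall>e\<in>arcs G. \<forall>x\<in>{0..ell e}. f e x = trig k (F (tail G e)) (B e) x"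
  shows "(\<Sum>e\<in>out_arcs G v \<union> in_arcs G v. outward_derivative G ell f v e) =
     of_real k * ((\<Sum>e | e \<in> arcs G \<and> head G e = v. edge_cos ell k e * B e - edge_sin ell k e * F (tail G e)) -
       (\<Sum>e | e \<in> arcs G \<and> tail G e = v. B e))"
proof -
  note os = trig_one_sided[OF length_pos bspec[OF f]]
  have "(\<Sum>e\<in>out_arcs G v \<union> in_arcs G v. outward_derivative G ell f v e) =
      (\<Sum>e\<in>out_arcs G v. outward_derivative G ell f v e) + (\<Sum>e\<in>in_arcs G v. outward_derivative G ell f v e)"
    by (rule sum.union_disjoint) (auto dest: no_loops)
  also have "(\<Sum>e\<in>out_arcs G v. outward_derivative G ell f v e) =
      (\<Sum>e | e \<in> arcs G \<and> tail G e = v. - (of_real k * B e))"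
    by (rule sum.cong) (auto simp: outward_derivative_def os(3))
  also have "(\<Sum>e\<in>in_arcs G v. outward_derivative G ell f v e) =
      (\<Sum>e | e \<in> arcs G \<and> head G e = v. of_real k * (edge_cos ell k e * B e - edge_sin ell k e * F (tail G e)))"
    by (rule sum.cong) (auto simp: outward_derivative_def os(4) edge_cos_def edge_sin_def dest: no_loops)
  finally show ?thesis
    unfolding sum_negf sum_distrib_left[symmetric] by (simp add: right_diff_distrib)
qed

lemma trig_family_vertex_value:
  assumes "robin_solution G (verts G) (arcs G) (edge_cos ell k) (edge_sin ell k) (\<lambda>_. 0) F B"
  shows "has_vertex_value G ell (trig_family G ell k F B) v (F v)"
proof -
  have f: "\<forall>e\<in>arcs G. \<forall>x\<in>{0..ell e}. trig_family G ell k F B e x = trig k (F (tail G e)) (B e) x"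
    by (simp add: trig_family_def)
  have "F (head G e) = trig k (F (tail G e)) (B e) (ell e)" if "e \<in> arcs G" for e
    using assms that by (simp add: robin_solution_def trig_def edge_cos_def edge_sin_def)
  with trig_one_sided(1,2)[OF length_pos bspec[OF f]] show ?thesis
    unfolding has_vertex_value_def in_arcs_def out_arcs_def by fastforce
qed

lemma trig_family_eigenspace:
  assumes "robin_solution G (verts G) (arcs G) (edge_cos ell k) (edge_sin ell k) (\<lambda>_. 0) F B"
  shows "trig_family G ell k F B \<in> eigenspace G ell (of_real (k\<^sup>2))"
proof -
  let ?f = "trig_family G ell k F B"
  have f: "\<forall>e\<in>arcs G. \<forall>x\<in>{0..ell e}. ?f e x = trig k (F (tail G e)) (B e) x"
    by (simp add: trig_family_def)
  note ts = trig_sobolev[OF less_imp_le[OF length_pos] bspec[OF f]]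
  have "?f \<in> edgewise_H2 G ell"
    unfolding edgewise_H2_def using ts(1,4) by (auto, auto simp: trig_family_def)
  moreover have "standard_conditions G ell ?f v" if "v \<in> verts G" for v
    unfolding standard_conditions_def sum_outward_derivative_trig[where F = F and B = B, OF f]
    using trig_family_vertex_value[OF assms] assms that by (auto simp: robin_solution_def)
  ultimately have "?f \<in> laplacian_domain G ell" by (simp add: laplacian_domain_def)
  moreover have "(\<lambda>x. of_real (k\<^sup>2) * ?f e x) \<in> L2_interval (ell e)" if "e \<in> arcs G" for e
    by (intro continuous_on_L2_interval continuous_intros ts(1) that)
  ultimately show ?thesis
    using ts(3) by (simp add: eigenspace_def neg_laplacian_def fun_scale_def)
qed

text \<open>Reduces the eigenvalue problem to linear algebra on Cauchy data. Positivity of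
  \<open>k\<close> enters twice: in the regularity of weak solutions, and in cancelling the factor
  \<open>k\<close> from the derivative condition.\<close>

lemma eigenspace_trig_family:
  assumes "0 < k" and "f \<in> eigenspace G ell (of_real (k\<^sup>2))"
  shows "\<exists>F B. f = trig_family G ell k F B \<and>
    robin_solution G (verts G) (arcs G) (edge_cos ell k) (edge_sin ell k) (\<lambda>_. 0) F B"
proof -
  have H: "f \<in> edgewise_H2 G ell" and sc: "\<And>v. v \<in> verts G \<Longrightarrow> standard_conditions G ell f v"
    and w: "\<And>e. e \<in> arcs G \<Longrightarrow> weak_derivative 2 (ell e) (f e) (\<lambda>x. - (of_real (k\<^sup>2) * f e x))"
    using assms(2) by (auto simp: eigenspace_def neg_laplacian_def laplacian_domain_def fun_scale_def)
  have c: "continuous_on {0..ell e} (f e)" if "e \<in> arcs G" for e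
    using H that by (simp add: edgewise_H2_def)
  have "\<forall>e\<in>arcs G. \<exists>A B. \<forall>x\<in>{0..ell e}. f e x = trig k A B x"
    unfolding trig_def using weak_solution_trig[OF c assms(1) length_pos w] by blast
  then obtain A B where AB: "\<And>e. e \<in> arcs G \<Longrightarrow> \<forall>x\<in>{0..ell e}. f e x = trig k (A e) (B e) x"
    by metis
  obtain F where F: "\<And>v. v \<in> verts G \<Longrightarrow> has_vertex_value G ell f v (F v)"
    using sc unfolding standard_conditions_def by metis
  note os = trig_one_sided[OF length_pos AB]
  have A: "A e = F (tail G e)" if e: "e \<in> arcs G" for e
  proof (rule tendsto_unique[OF _ os(1)[OF e e]])
    show "(f e \<longlongrightarrow> F (tail G e)) (at_right 0)"
      using F[of "tail G e"] e by (auto simp: has_vertex_value_def)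
  qed simp_all
  have head: "trig k (A e) (B e) (ell e) = F (head G e)" if e: "e \<in> arcs G" for e
  proof (rule tendsto_unique[OF _ os(2)[OF e e]])
    show "(f e \<longlongrightarrow> F (head G e)) (at_left (ell e))"
      using F[of "head G e"] e by (auto simp: has_vertex_value_def)
  qed simp_all
  have f: "\<forall>e\<in>arcs G. \<forall>x\<in>{0..ell e}. f e x = trig k (F (tail G e)) (B e) x"
    using AB A by simp
  have "f = trig_family G ell k F B"
    using H f by (auto simp: fun_eq_iff trig_family_def edgewise_H2_def)
  moreover have "robin_solution G (verts G) (arcs G) (edge_cos ell k) (edge_sin ell k) (\<lambda>_. 0) F B"
    unfolding robin_solution_def
  proof (intro conjI ballI)
    fix e assume "e \<in> arcs G"
    then show "F (head G e) = edge_cos ell k e * F (tail G e) + edge_sin ell k e * B e"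
      using head[of e] A[of e] by (simp add: trig_def edge_cos_def edge_sin_def)
  next
    fix v assume "v \<in> verts G"
    then show "(\<Sum>e | e \<in> arcs G \<and> head G e = v. edge_cos ell k e * B e - edge_sin ell k e * F (tail G e)) -
       (\<Sum>e | e \<in> arcs G \<and> tail G e = v. B e) = 0 * F v"
      using sc[of v] assms(1) unfolding standard_conditions_def sum_outward_derivative_trig[where F = F and B = B, OF f] by simp
  qed
  ultimately show ?thesis by blast
qed

text \<open>The definite description in \<open>vertex_value\<close> picks out the limit only if some
  arc meets \<open>v\<close>. Connectedness and \<open>arcs_nonempty\<close> exclude isolated
  vertices.\<close>

lemma connected_vertex_value:
  assumes "Digraph_Component.connected G" "v \<in> verts G" "has_vertex_value G ell f v c"
  shows "vertex_value G ell f v = c"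
  unfolding vertex_value_def
proof (rule the_equality)
  fix c' assume c': "has_vertex_value G ell f v c'"
  have "\<exists>e\<in>arcs G. tail G e = v \<or> head G e = v"
  proof (cases "{v} = verts G")
    case True
    obtain e where "e \<in> arcs G" using arcs_nonempty by blast
    then have "tail G e \<in> {v}" unfolding True by simp
    with \<open>e \<in> arcs G\<close> show ?thesis by auto
  next
    case False
    then show ?thesis
      using connected_crossing_arc[OF assms(1), of "{v}"] assms(2) by (force simp: doubleton_eq_iff)
  qed
  then obtain e where e: "e \<in> arcs G" "tail G e = v \<or> head G e = v" by blast
  from e(2) show "c' = c"
  proof
    assume "tail G e = v"
    then show ?thesis using e c' assms(3) tendsto_unique[of "at_right (0::real)" "f e" c' c]
      by (auto simp: has_vertex_value_def)
  next
    assume "head G e = v"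
    then show ?thesis using e c' assms(3) tendsto_unique[of "at_left (ell e)" "f e" c' c]
      by (auto simp: has_vertex_value_def)
  qed
qed fact

section \<open>Arbitrarily large simple eigenvalues\<close>

lemma simultaneous_near_period:
  assumes "0 < \<delta>"
  shows "\<exists>T\<ge>K. \<forall>e\<in>arcs G. \<exists>N::int. \<bar>T * ell e - 2 * pi * of_int N\<bar> < \<delta>"
proof -
  \<comment> \<open>Dirichlet's theorem gives a positive integer \<open>q\<close> but no lower bound
    beyond 1. Applying it to the lengths scaled by \<open>K'\<close> makes \<open>q * K'\<close> at
    least \<open>K\<close>.\<close>
  define K' where "K' = max K 1"
  obtain N :: nat where N: "2 * pi / \<delta> < real N" using reals_Archimedean2 by blast
  then have N0: "0 < N" using assms by (cases "N = 0") (auto simp: divide_less_0_iff not_less[symmetric] pi_gt_zero order_less_asym)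
  obtain h where h: "bij_betw h {0..<card (arcs G)} (arcs G)" using ex_bij_betw_nat_finite[OF finite_arcs] by blast
  obtain q p where qp: "0 < q" 
    "\<And>i. i < card (arcs G) \<Longrightarrow> \<bar>of_int q * (K' * ell (h i) / (2 * pi)) - of_int (p i)\<bar> < 1 / N"
    using Dirichlet_approx_simult[OF N0, of "card (arcs G)" "\<lambda>i. K' * ell (h i) / (2 * pi)"] by metis
  have "\<exists>N::int. \<bar>of_int q * K' * ell e - 2 * pi * of_int N\<bar> < \<delta>" if "e \<in> arcs G" for e
  proof -
    obtain i where i: "i < card (arcs G)" "e = h i" using h \<open>e \<in> arcs G\<close> by (force simp: bij_betw_def)
    have "of_int q * K' * ell e - 2 * pi * of_int (p i) =
        2 * pi * (of_int q * (K' * ell (h i) / (2 * pi)) - of_int (p i))"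
      by (simp add: i field_simps)
    then have "\<bar>of_int q * K' * ell e - 2 * pi * of_int (p i)\<bar> =
        2 * pi * \<bar>of_int q * (K' * ell (h i) / (2 * pi)) - of_int (p i)\<bar>"
      by (simp add: abs_mult)
    also have "\<dots> \<le> 2 * pi * (1 / N)" by (intro mult_left_mono less_imp_le[OF qp(2)] i(1)) simp
    also have "\<dots> < \<delta>" using N N0 assms by (simp add: field_simps)
    finally show ?thesis by blast
  qed
  moreover have "K \<le> of_int q * K'"
  proof -
    have "1 * K' \<le> of_int q * K'" using qp(1) by (intro mult_right_mono) (auto simp: K'_def)
    then show ?thesis by (simp add: K'_def)
  qed
  ultimately show ?thesis by blast
qed

lemma robin_solution_above:
  assumes T: "grown_tree G (verts G) (arcs G)"
  shows "\<exists>k>K. \<exists>F B. robin_solution G (verts G) (arcs G) (\<lambda>e. cos (k * ell e)) (\<lambda>e. sin (k * ell e))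
      (\<lambda>_. 0 :: real) F B \<and> (\<forall>v\<in>verts G. F v \<noteq> 0)"
proof -
  define m M where "m = Min (ell ` arcs G)" and "M = Max (ell ` arcs G)"
  have mM: "m \<le> ell e" "ell e \<le> M" if "e \<in> arcs G" for e
    using that by (auto simp: m_def M_def)
  have "0 < m" unfolding m_def using arcs_nonempty length_pos by (subst Min_gr_iff) auto
  obtain e0 where "e0 \<in> arcs G" using arcs_nonempty by blast
  then have "0 < M" using mM[of e0] \<open>0 < m\<close> by linarith
  define \<delta> where "\<delta> = (1 / 4 ^ card (verts G) :: real)"
  have \<delta>: "0 < \<delta>" "\<delta> \<le> 1" "4 ^ card (verts G) * \<delta> \<le> 1"
    by (auto simp: \<delta>_def divide_le_eq_1)
  \<comment> \<open>At \<open>T0\<close> every phase is within \<open>\<eta>\<close> of a multiple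
    of \<open>2 * pi\<close>. Moving \<open>k\<close> by \<open>\<eta> / m\<close> shifts even the
    shortest edge's phase by \<open>\<eta>\<close>, enough to cross that multiple, and the longest
    edge's phase by \<open>\<eta> / m * M\<close>; \<open>\<eta>\<close> makes the total deviation
    exactly \<open>\<delta>\<close>.\<close>
  define \<eta> where "\<eta> = \<delta> / (1 + M / m)"
  have \<eta>: "0 < \<eta>" "\<eta> + \<eta> / m * M = \<delta>"
  proof -
    have "0 < 1 + M / m" using \<open>0 < m\<close> \<open>0 < M\<close> by (simp add: add_pos_pos)
    then show "0 < \<eta>" using \<delta>(1) by (simp add: \<eta>_def)
    have "\<eta> * (1 + M / m) = \<delta>" using \<open>0 < 1 + M / m\<close> by (simp add: \<eta>_def)
    then show "\<eta> + \<eta> / m * M = \<delta>" by (simp add: distrib_left)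
  qed
  obtain T0 where T0: "K + 1 + \<eta> / m \<le> T0"
    "\<forall>e\<in>arcs G. \<exists>N::int. \<bar>T0 * ell e - 2 * pi * of_int N\<bar> < \<eta>"
    using simultaneous_near_period[OF \<eta>(1)] by blast
  then obtain N where N: "\<And>e. e \<in> arcs G \<Longrightarrow> \<bar>T0 * ell e - 2 * pi * of_int (N e)\<bar> < \<eta>" by metis
  define lo hi where "lo = T0 - \<eta> / m" and "hi = T0 + \<eta> / m"
  have "0 < \<eta> / m" using \<eta>(1) \<open>0 < m\<close> by simp
  have per: "sin (k * ell e) = sin (k * ell e - 2 * pi * of_int (N e))"
    "cos (k * ell e) = cos (k * ell e - 2 * pi * of_int (N e))" for k e
    by (simp_all add: sin_diff cos_diff sin_int_2pin cos_int_2pin)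
  have near: "\<bar>k * ell e - 2 * pi * of_int (N e)\<bar> \<le> \<delta>" if "k \<in> {lo..hi}" "e \<in> arcs G" for k e
  proof -
    have "k * ell e - 2 * pi * of_int (N e) = (T0 * ell e - 2 * pi * of_int (N e)) + (k - T0) * ell e"
      by (simp add: algebra_simps)
    also have "\<bar>\<dots>\<bar> \<le> \<bar>T0 * ell e - 2 * pi * of_int (N e)\<bar> + \<bar>(k - T0) * ell e\<bar>" by (rule abs_triangle_ineq)
    also have "\<dots> \<le> \<eta> + \<eta> / m * M"
    proof (rule add_mono)
      have "\<bar>k - T0\<bar> \<le> \<eta> / m" using that(1) by (auto simp: lo_def hi_def)
      then show "\<bar>(k - T0) * ell e\<bar> \<le> \<eta> / m * M"
        unfolding abs_mult using mM[OF that(2)] length_pos[OF that(2)] \<open>0 < \<eta> / m\<close>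
        by (intro mult_mono) auto
    qed (use N[OF that(2)] in auto)
    finally show ?thesis unfolding \<eta>(2) .
  qed
  have "\<exists>k\<in>{lo..hi}. \<exists>F B. robin_solution G (verts G) (arcs G) (\<lambda>e. cos (k * ell e)) (\<lambda>e. sin (k * ell e))
      (\<lambda>_. 0 :: real) F B \<and> (\<forall>v\<in>verts G. F v \<noteq> 0)"
  proof (rule robin_solution_exists[OF T, where \<delta> = \<delta>])
    show "lo \<le> hi" using \<open>0 < \<eta> / m\<close> by (simp add: lo_def hi_def)
    fix e assume e: "e \<in> arcs G"
    show "continuous_on {lo..hi} (\<lambda>k. cos (k * ell e))" "continuous_on {lo..hi} (\<lambda>k. sin (k * ell e))"
      by (intro continuous_intros)+
    have "\<eta> \<le> \<eta> / m * ell e"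
      using mM(1)[OF e] \<eta>(1) \<open>0 < m\<close> by (simp add: field_simps)
    moreover have "lo * ell e = T0 * ell e - \<eta> / m * ell e" "hi * ell e = T0 * ell e + \<eta> / m * ell e"
      by (simp_all add: lo_def hi_def left_diff_distrib distrib_right)
    ultimately have "lo * ell e - 2 * pi * of_int (N e) \<le> 0" "0 \<le> hi * ell e - 2 * pi * of_int (N e)"
      using N[OF e] by linarith+
    moreover have "\<bar>lo * ell e - 2 * pi * of_int (N e)\<bar> \<le> \<delta>" "\<bar>hi * ell e - 2 * pi * of_int (N e)\<bar> \<le> \<delta>"
      using \<open>lo \<le> hi\<close> by (auto intro!: near e)
    ultimately show "sin (lo * ell e) \<le> 0 \<and> 0 \<le> sin (hi * ell e)"
      unfolding per(1) using \<delta>(2) pi_gt3 sin_ge_zero[of "hi * ell e - 2 * pi * of_int (N e)"]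
        sin_ge_zero[of "- (lo * ell e - 2 * pi * of_int (N e))"] unfolding sin_minus by linarith
    fix k assume k: "k \<in> {lo..hi}"
    note n = near[OF k e]
    have "\<bar>sin (k * ell e)\<bar> \<le> \<delta>"
      unfolding per(1) using abs_sin_x_le_abs_x n by (rule order_trans)
    moreover have "0 < cos (k * ell e)"
      unfolding per(2) using n \<delta>(2) pi_gt3 by (intro cos_gt_zero_pi) linarith+
    ultimately show "(cos (k * ell e))\<^sup>2 + (sin (k * ell e))\<^sup>2 = 1 \<and> 0 < cos (k * ell e) \<and> \<bar>sin (k * ell e)\<bar> \<le> \<delta>"
      by simp
  qed (use \<delta> in auto)
  then obtain k where "k \<in> {lo..hi}" and k: "\<exists>F B. robin_solution G (verts G) (arcs G) (\<lambda>e. cos (k * ell e))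
      (\<lambda>e. sin (k * ell e)) (\<lambda>_. 0 :: real) F B \<and> (\<forall>v\<in>verts G. F v \<noteq> 0)"
    by (rule bexE)
  moreover have "K < lo" using T0(1) by (simp add: lo_def)
  ultimately have "K < k" by simp
  with k show ?thesis by blast
qed

lemma undirected_tree_simple_eigenvalue_above:
  assumes "undirected_tree G"
  shows "\<exists>k>K. is_eigenvalue G ell (of_real (k\<^sup>2)) \<and> eigenvalue_multiplicity G ell (of_real (k\<^sup>2)) = 1 \<and>
     (\<exists>f. neg_laplacian G ell f (fun_scale (of_real (k\<^sup>2)) f) \<and> f \<noteq> 0 \<and> (\<forall>v\<in>verts G. vertex_value G ell f v \<noteq> 0))"
proof -
  note T = undirected_tree_grown[OF assms]
  \<comment> \<open>Besides exceeding \<open>K\<close>, \<open>k\<close> has to be positive for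
    \<open>eigenspace_trig_family\<close>.\<close>
  obtain k F B where k: "max K 0 < k" and sol: "robin_solution G (verts G) (arcs G)
      (\<lambda>e. cos (k * ell e)) (\<lambda>e. sin (k * ell e)) (\<lambda>_. 0 :: real) F B" and F: "\<forall>v\<in>verts G. F v \<noteq> 0"
    using robin_solution_above[OF T] by blast
  define F' B' where "F' v = complex_of_real (F v)" and "B' e = complex_of_real (B e)" for v e
  have sol': "robin_solution G (verts G) (arcs G) (edge_cos ell k) (edge_sin ell k) (\<lambda>_. 0) F' B'"
    using robin_solution_of_real[OF sol, where 'a = complex]
    by (simp add: F'_def[abs_def] B'_def[abs_def] edge_cos_def[abs_def] edge_sin_def[abs_def])
  have F': "F' v \<noteq> 0" if "v \<in> verts G" for v using F that by (simp add: F'_def)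
  define f where "f = trig_family G ell k F' B'"
  have f: "f \<in> eigenspace G ell (of_real (k\<^sup>2))"
    unfolding f_def by (rule trig_family_eigenspace[OF sol'])
  have val: "vertex_value G ell f v = F' v" if "v \<in> verts G" for v
    unfolding f_def using assms that
    by (intro connected_vertex_value trig_family_vertex_value[OF sol']) (simp_all add: undirected_tree_def)
  have "f \<noteq> 0"
  proof
    assume "f = 0"
    obtain e where e: "e \<in> arcs G" using arcs_nonempty by blast
    then have "f e 0 = F' (tail G e)"
      using length_pos[OF e] by (simp add: f_def trig_family_def trig_def)
    with F' e \<open>f = 0\<close> show False by (simp add: zero_fun_def)
  qed
  have cs: "(edge_cos ell k e)\<^sup>2 + (edge_sin ell k e)\<^sup>2 = 1" for e
    unfolding edge_cos_def edge_sin_def by (simp flip: of_real_power of_real_add)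
  have "eigenspace G ell (of_real (k\<^sup>2)) \<subseteq> fun_scale.span {f}"
  proof
    fix g assume "g \<in> eigenspace G ell (of_real (k\<^sup>2))"
    then obtain H C where g: "g = trig_family G ell k H C"
      and "robin_solution G (verts G) (arcs G) (edge_cos ell k) (edge_sin ell k) (\<lambda>_. 0) H C"
      using eigenspace_trig_family k by (metis max_less_iff_conj)
    from robin_solution_unique[OF T cs sol' F' this(2)]
    obtain q where q: "\<forall>v\<in>verts G. H v = q * F' v" "\<forall>e\<in>arcs G. C e = q * B' e" by blast
    have "g = fun_scale q f"
      unfolding g f_def fun_scale_def fun_eq_iff trig_family_def trig_def using q
      by (auto simp: algebra_simps)
    then show "g \<in> fun_scale.span {f}"
      by (simp add: fun_scale.span_base fun_scale.span_scale)
  qed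
  then have "fun_scale.dim (eigenspace G ell (of_real (k\<^sup>2))) = 1"
    using f \<open>f \<noteq> 0\<close> by (intro fun_scale.dim_unique[of "{f}"]) auto
  with f k \<open>f \<noteq> 0\<close> val F' show ?thesis
    unfolding is_eigenvalue_def eigenvalue_multiplicity_def eigenspace_def
    by (intro exI[of _ k]) auto
qed

end

theorem theorem1:
  fixes G :: "('v, 'e) pre_digraph" and ell :: "'e \<Rightarrow> real"
  assumes "compact_metric_graph G ell"
    and "undirected_tree G"
  shows "\<exists>(lam :: nat \<Rightarrow> real) (psi :: nat \<Rightarrow> 'e \<Rightarrow> real \<Rightarrow> complex).
           strict_mono lam \<and>
           (\<forall>k. is_eigenvalue G ell (complex_of_real (lam k)) \<and>
                eigenvalue_multiplicity G ell (complex_of_real (lam k)) = 1 \<and>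
                neg_laplacian G ell (psi k) (fun_scale (complex_of_real (lam k)) (psi k)) \<and>
                psi k \<noteq> 0 \<and>
                (\<forall>v\<in>verts G. vertex_value G ell (psi k) v \<noteq> 0))"
proof -
  define P where "P k f \<longleftrightarrow> is_eigenvalue G ell (of_real (k\<^sup>2)) \<and>
     eigenvalue_multiplicity G ell (of_real (k\<^sup>2)) = 1 \<and>
     neg_laplacian G ell f (fun_scale (of_real (k\<^sup>2)) f) \<and> f \<noteq> 0 \<and>
     (\<forall>v\<in>verts G. vertex_value G ell f v \<noteq> 0)" for k f
  have ex: "\<exists>k>K. \<exists>f. P k f" for K
    unfolding P_def
    using compact_metric_graph.undirected_tree_simple_eigenvalue_above[OF assms, of K] by blast
  \<comment> \<open>Positivity is carried through the choice because the eigenvalues are the squares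
    of the \<open>k n\<close>, and squaring is increasing only on nonnegative numbers.\<close>
  obtain k where k: "\<And>n. 0 < k n \<and> (\<exists>f. P (k n) f)" "\<And>n. k n < k (Suc n)"
  proof -
    have "\<exists>k. \<forall>n. (0 < k n \<and> (\<exists>f. P (k n) f)) \<and> k n < k (Suc n)"
    proof (rule dependent_nat_choice)
      show "\<exists>x. 0 < x \<and> (\<exists>f. P x f)" using ex by blast
      show "\<exists>y. (0 < y \<and> (\<exists>f. P y f)) \<and> x < y" if "0 < x \<and> (\<exists>f. P x f)" for x n
        using ex[of x] that by (meson order_less_trans)
    qed
    then show ?thesis using that by blast
  qed
  then obtain psi where "\<And>n. P (k n) (psi n)" by metis
  moreover have "strict_mono (\<lambda>n. (k n)\<^sup>2)"
    unfolding strict_mono_Suc_iff using k by (auto intro!: power_strict_mono less_imp_le)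
  ultimately show ?thesis
    unfolding P_def by (intro exI[of _ "\<lambda>n. (k n)\<^sup>2"] exI[of _ psi]) blast
qed

end
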